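(* Let $B$ be a discrete abelian group, $\alpha\in\mathrm{Aut}(B)$, $K=\hat B$ with normalized Haar measure $\mu$, $G=B\rtimes_\alpha\mathbb{Z}$, and let $H$ be a subgroup of $B$ satisfying $$\alpha(H)\subset H,\qquad \bigcup_{n\ge0}\alpha^{-n}(H)=B.$$ Define operators $u$ and $t_h$ ($h\in H$) on $L^2(\hat H,\mu_H)$ by $(uf)(z)=f(\hat\alpha_H(z))$ and $(t_hf)(z)=z(h)f(z)$ for $z\in\hat H$. (i) These operators satisfy $u\,t_h=t_{\alpha(h)}\,u$ for all $h\in H$. Moreover the operators $t_h$ are unitary for all $h\in H$, and $u$ is an isometry. (ii) Let $W:L^2(\hat H,\mu_H)\to L^2(K,\mu)$, $Wf=f\circ\theta_0$, and let $U$ be the unitary representation of $G$ on $L^2(K,\mu)$ given by $(U(j,b)f)(\chi)=\chi(b)f(\hat\alpha^j(\chi))$. Then $W$ is an isometry with the property that $$Wu=U(1,0)W,\qquad Wt_h=U(0,h)W\quad(h\in H).$$ Moreover $U$ is the minimal unitary dilation of the isometry $u$, i.e. $$\bigcup_{j\ge0}U(-j,0)\big[WL^2(\hat H,\mu_H)\big]\ \text{ is dense in }L^2(K,\mu).$$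
   Context: $\hat B,\hat H$ are Pontryagin duals of the discrete groups $B,H$. $\hat\alpha\in\mathrm{Aut}(K)$ is $(\hat\alpha\chi)(b)=\chi(\alpha(b))$. The group $G=B\rtimes_\alpha\mathbb{Z}$ is $\mathbb{Z}\times B$ with product $(j,b)(k,c)=(j+k,\alpha^j(c)+b)$. The morphism $\theta_0:\hat B\to\hat H$ is dual to the inclusion $H\hookrightarrow B$, i.e. restriction of characters to $H$. $\mu_H:=\mu\circ\theta_0^{-1}$, which is the normalized Haar measure of $\hat H$. $\hat\alpha_H:\hat H\to\hat H$ is the dual of the injective endomorphism $\alpha_H=\alpha|_H$ of $H$, i.e. $(\hat\alpha_H z)(h)=z(\alpha(h))$; it satisfies $\theta_0\circ\hat\alpha=\hat\alpha_H\circ\theta_0$. *)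

theory Defs
  imports "HOL-Analysis.Analysis" "HOL-Algebra.Bij"
begin

section \<open>Pontryagin duals of discrete abelian groups\<close>

definition circle_group :: "complex monoid" where
  "circle_group = \<lparr>carrier = sphere 0 1, mult = (*), one = 1\<rparr>"

text \<open>Characters are made extensional so that equal characters are equal functions.\<close>

definition dual_group :: "('b, 'm) monoid_scheme \<Rightarrow> ('b \<Rightarrow> complex) monoid" where
  "dual_group B =
     \<lparr>carrier = hom B circle_group \<inter> extensional (carrier B),
      mult = (\<lambda>\<xi> \<psi>. \<lambda>b\<in>carrier B. \<xi> b * \<psi> b),
      one = (\<lambda>b\<in>carrier B. 1)\<rparr>"

text \<open>For a discrete group the compact-open topology on the dual is the topology of
  pointwise convergence.\<close>

definition dual_topology :: "('b, 'm) monoid_scheme \<Rightarrow> ('b \<Rightarrow> complex) topology" where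
  "dual_topology B =
     subtopology (product_topology (\<lambda>_. euclidean) (carrier B)) (carrier (dual_group B))"

text \<open>The dual of a homomorphism \<open>\<phi>\<close> from \<open>A\<close> to \<open>B\<close>, as a map from the dual of \<open>B\<close>
  to the dual of \<open>A\<close>.\<close>

definition dual_map ::
    "('a, 'm) monoid_scheme \<Rightarrow> ('b, 'n) monoid_scheme \<Rightarrow> ('a \<Rightarrow> 'b)
      \<Rightarrow> ('b \<Rightarrow> complex) \<Rightarrow> ('a \<Rightarrow> complex)" where
  "dual_map A B \<phi> = (\<lambda>\<xi>\<in>carrier (dual_group B). \<lambda>a\<in>carrier A. \<xi> (\<phi> a))"


section \<open>Normalized Haar measure\<close>

definition borel_sets_of :: "'a topology \<Rightarrow> 'a measure" where
  "borel_sets_of X = sigma (topspace X) {U. openin X U}"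

text \<open>A translation-invariant Radon probability measure on the group \<open>G\<close> with topology \<open>X\<close>
  (meant for compact groups). The dual of an uncountable group is not metrizable, so the
  regularity conditions do not follow from the others.\<close>

definition normalized_haar_measure ::
    "('a, 'm) monoid_scheme \<Rightarrow> 'a topology \<Rightarrow> 'a measure \<Rightarrow> bool" where
  "normalized_haar_measure G X \<mu> \<longleftrightarrow>
     space \<mu> = topspace X \<and>
     sets \<mu> = sets (borel_sets_of X) \<and>
     emeasure \<mu> (space \<mu>) = 1 \<and>
     (\<forall>g\<in>carrier G. \<forall>A\<in>sets \<mu>. emeasure \<mu> ((\<lambda>x. g \<otimes>\<^bsub>G\<^esub> x) ` A) = emeasure \<mu> A) \<and>
     (\<forall>A\<in>sets \<mu>. emeasure \<mu> A = (INF U\<in>{U. openin X U \<and> A \<subseteq> U}. emeasure \<mu> U)) \<and>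
     (\<forall>U. openin X U \<longrightarrow>
        emeasure \<mu> U = (SUP C\<in>{C. compactin X C \<and> closedin X C \<and> C \<subseteq> U}. emeasure \<mu> C))"


section \<open>The Hilbert space of classes of square-integrable functions\<close>

definition square_integrable :: "'a measure \<Rightarrow> ('a \<Rightarrow> complex) set" where
  "square_integrable M =
     {f. f \<in> borel_measurable M \<and> integrable M (\<lambda>x. (cmod (f x))\<^sup>2)}"

definition ae_rel :: "'a measure \<Rightarrow> (('a \<Rightarrow> complex) \<times> ('a \<Rightarrow> complex)) set" where
  "ae_rel M = {(f, g). f \<in> square_integrable M \<and> g \<in> square_integrable M \<and>
                       (AE x in M. f x = g x)}"

definition L2 :: "'a measure \<Rightarrow> ('a \<Rightarrow> complex) set set" where
  "L2 M = square_integrable M // ae_rel M"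

definition l2_class :: "'a measure \<Rightarrow> ('a \<Rightarrow> complex) \<Rightarrow> ('a \<Rightarrow> complex) set" where
  "l2_class M f = ae_rel M `` {f}"

text \<open>The operations on classes are unions over representatives, as in the theory of quotients
  by equivalence relations. Such a union is again a class only if the operation on
  representatives preserves square-integrability and respects equality almost everywhere.\<close>

definition l2_add ::
    "'a measure \<Rightarrow> ('a \<Rightarrow> complex) set \<Rightarrow> ('a \<Rightarrow> complex) set \<Rightarrow> ('a \<Rightarrow> complex) set" where
  "l2_add M F G = (\<Union>f\<in>F. \<Union>g\<in>G. l2_class M (\<lambda>x. f x + g x))"

definition l2_scale ::
    "'a measure \<Rightarrow> complex \<Rightarrow> ('a \<Rightarrow> complex) set \<Rightarrow> ('a \<Rightarrow> complex) set" where
  "l2_scale M c F = (\<Union>f\<in>F. l2_class M (\<lambda>x. c * f x))"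

definition l2_inner ::
    "'a measure \<Rightarrow> ('a \<Rightarrow> complex) set \<Rightarrow> ('a \<Rightarrow> complex) set \<Rightarrow> complex" where
  "l2_inner M F G = the_elem (\<Union>f\<in>F. \<Union>g\<in>G. {LINT x|M. f x * cnj (g x)})"

definition l2_norm :: "'a measure \<Rightarrow> ('a \<Rightarrow> complex) set \<Rightarrow> real" where
  "l2_norm M F = sqrt (Re (l2_inner M F F))"

definition l2_lift ::
    "'a measure \<Rightarrow> 'c measure \<Rightarrow> (('a \<Rightarrow> complex) \<Rightarrow> ('c \<Rightarrow> complex))
      \<Rightarrow> ('a \<Rightarrow> complex) set \<Rightarrow> ('c \<Rightarrow> complex) set" where
  "l2_lift M N \<Phi> F = (\<Union>f\<in>F. l2_class N (\<Phi> f))"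

definition l2_linear ::
    "'a measure \<Rightarrow> 'c measure \<Rightarrow> (('a \<Rightarrow> complex) set \<Rightarrow> ('c \<Rightarrow> complex) set) \<Rightarrow> bool" where
  "l2_linear M N T \<longleftrightarrow>
     T \<in> L2 M \<rightarrow> L2 N \<and>
     (\<forall>F\<in>L2 M. \<forall>G\<in>L2 M. T (l2_add M F G) = l2_add N (T F) (T G)) \<and>
     (\<forall>c. \<forall>F\<in>L2 M. T (l2_scale M c F) = l2_scale N c (T F))"

definition l2_isometry ::
    "'a measure \<Rightarrow> 'c measure \<Rightarrow> (('a \<Rightarrow> complex) set \<Rightarrow> ('c \<Rightarrow> complex) set) \<Rightarrow> bool" where
  "l2_isometry M N T \<longleftrightarrow>
     l2_linear M N T \<and> (\<forall>F\<in>L2 M. l2_norm N (T F) = l2_norm M F)"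

definition l2_unitary ::
    "'a measure \<Rightarrow> (('a \<Rightarrow> complex) set \<Rightarrow> ('a \<Rightarrow> complex) set) \<Rightarrow> bool" where
  "l2_unitary M T \<longleftrightarrow>
     l2_linear M M T \<and> bij_betw T (L2 M) (L2 M) \<and>
     (\<forall>F\<in>L2 M. \<forall>G\<in>L2 M. l2_inner M (T F) (T G) = l2_inner M F G)"

definition l2_dense :: "'a measure \<Rightarrow> ('a \<Rightarrow> complex) set set \<Rightarrow> bool" where
  "l2_dense M S \<longleftrightarrow>
     S \<subseteq> L2 M \<and>
     (\<forall>F\<in>L2 M. \<forall>e>0. \<exists>G\<in>S. l2_norm M (l2_add M F (l2_scale M (-1) G)) < e)"

text \<open>Unitary representations of a discrete group, so without a continuity condition.\<close>

definition unitary_representation ::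
    "('g, 'm) monoid_scheme \<Rightarrow> 'a measure
      \<Rightarrow> ('g \<Rightarrow> ('a \<Rightarrow> complex) set \<Rightarrow> ('a \<Rightarrow> complex) set) \<Rightarrow> bool" where
  "unitary_representation G M U \<longleftrightarrow>
     (\<forall>g\<in>carrier G. l2_unitary M (U g)) \<and>
     (\<forall>F\<in>L2 M. U \<one>\<^bsub>G\<^esub> F = F) \<and>
     (\<forall>g\<in>carrier G. \<forall>h\<in>carrier G. \<forall>F\<in>L2 M. U (g \<otimes>\<^bsub>G\<^esub> h) F = U g (U h F))"


section \<open>The semidirect product and the operators\<close>

text \<open>The groups are written multiplicatively; \<open>\<alpha>\<close> is an element of \<open>auto B\<close>, and its integer
  powers are those of the group \<open>AutoGroup B\<close>.\<close>

definition semidirect_int ::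
    "('b, 'm) monoid_scheme \<Rightarrow> ('b \<Rightarrow> 'b) \<Rightarrow> (int \<times> 'b) monoid" where
  "semidirect_int B \<alpha> =
     \<lparr>carrier = UNIV \<times> carrier B,
      mult = (\<lambda>(j, b) (k, c). (j + k, (\<alpha> [^]\<^bsub>AutoGroup B\<^esub> j) c \<otimes>\<^bsub>B\<^esub> b)),
      one = (0, \<one>\<^bsub>B\<^esub>)\<rparr>"

abbreviation subgroup_of :: "('b, 'm) monoid_scheme \<Rightarrow> 'b set \<Rightarrow> ('b, 'm) monoid_scheme" where
  "subgroup_of B H \<equiv> B\<lparr>carrier := H\<rparr>"

definition dual_aut :: "('b, 'm) monoid_scheme \<Rightarrow> ('b \<Rightarrow> 'b) \<Rightarrow> ('b \<Rightarrow> complex) \<Rightarrow> ('b \<Rightarrow> complex)"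
  where "dual_aut B \<alpha> = dual_map B B \<alpha>"

definition dual_endo_sub ::
    "('b, 'm) monoid_scheme \<Rightarrow> 'b set \<Rightarrow> ('b \<Rightarrow> 'b) \<Rightarrow> ('b \<Rightarrow> complex) \<Rightarrow> ('b \<Rightarrow> complex)" where
  "dual_endo_sub B H \<alpha> = dual_map (subgroup_of B H) (subgroup_of B H) (restrict \<alpha> H)"

definition theta0 :: "('b, 'm) monoid_scheme \<Rightarrow> 'b set \<Rightarrow> ('b \<Rightarrow> complex) \<Rightarrow> ('b \<Rightarrow> complex)" where
  "theta0 B H = dual_map (subgroup_of B H) B (\<lambda>h. h)"

definition mu_sub ::
    "('b, 'm) monoid_scheme \<Rightarrow> 'b set \<Rightarrow> ('b \<Rightarrow> complex) measure \<Rightarrow> ('b \<Rightarrow> complex) measure" where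
  "mu_sub B H \<mu> = distr \<mu> (borel_sets_of (dual_topology (subgroup_of B H))) (theta0 B H)"

definition op_u ::
    "('b, 'm) monoid_scheme \<Rightarrow> 'b set \<Rightarrow> ('b \<Rightarrow> 'b) \<Rightarrow> ('b \<Rightarrow> complex) measure
      \<Rightarrow> (('b \<Rightarrow> complex) \<Rightarrow> complex) set \<Rightarrow> (('b \<Rightarrow> complex) \<Rightarrow> complex) set" where
  "op_u B H \<alpha> \<mu> =
     l2_lift (mu_sub B H \<mu>) (mu_sub B H \<mu>) (\<lambda>f z. f (dual_endo_sub B H \<alpha> z))"

definition op_t ::
    "('b, 'm) monoid_scheme \<Rightarrow> 'b set \<Rightarrow> ('b \<Rightarrow> complex) measure \<Rightarrow> 'b
      \<Rightarrow> (('b \<Rightarrow> complex) \<Rightarrow> complex) set \<Rightarrow> (('b \<Rightarrow> complex) \<Rightarrow> complex) set" where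
  "op_t B H \<mu> h = l2_lift (mu_sub B H \<mu>) (mu_sub B H \<mu>) (\<lambda>f z. z h * f z)"

definition op_W ::
    "('b, 'm) monoid_scheme \<Rightarrow> 'b set \<Rightarrow> ('b \<Rightarrow> complex) measure
      \<Rightarrow> (('b \<Rightarrow> complex) \<Rightarrow> complex) set \<Rightarrow> (('b \<Rightarrow> complex) \<Rightarrow> complex) set" where
  "op_W B H \<mu> = l2_lift (mu_sub B H \<mu>) \<mu> (\<lambda>f \<xi>. f (theta0 B H \<xi>))"

definition rep_U ::
    "('b, 'm) monoid_scheme \<Rightarrow> ('b \<Rightarrow> 'b) \<Rightarrow> ('b \<Rightarrow> complex) measure \<Rightarrow> int \<times> 'b
      \<Rightarrow> (('b \<Rightarrow> complex) \<Rightarrow> complex) set \<Rightarrow> (('b \<Rightarrow> complex) \<Rightarrow> complex) set" where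
  "rep_U B \<alpha> \<mu> = (\<lambda>(j, b).
     l2_lift \<mu> \<mu> (\<lambda>f \<xi>. \<xi> b * f ((dual_aut B \<alpha> [^]\<^bsub>AutoGroup (dual_group B)\<^esub> j) \<xi>)))"

end

theory Submission
  imports Defs
begin

text \<open>Write \<open>K\<close> for the dual of \<open>B\<close>. Every operator in the theorem has the form \<open>f \<mapsto> w \<cdot> (f \<circ> T)\<close> with a
  weight \<open>w\<close> of modulus one, namely evaluation of characters at a group element, and a map \<open>T\<close> between
  dual groups. Such an operator is a well-defined isometry of \<open>L\<^sup>2\<close> classes as soon as \<open>T\<close> preserves the
  measures (locale \<open>unimodular_composition\<close>). The intertwining relations, the group law of \<open>U\<close> and the
  inverses that make \<open>t\<^sub>h\<close> and \<open>U(j,b)\<close> unitary then are pointwise identities between characters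
  (\<open>weighted_composition_square\<close>, \<open>weighted_composition_unitary\<close>). Two analytic facts remain.

  The first is that the dual of an automorphism preserves Haar measure (\<open>dual_aut_preserves_haar\<close>). The
  image of \<open>\<mu>\<close> is again translation invariant, and two invariant probability measures \<open>\<mu>\<close>, \<open>\<nu>\<close> agree on
  \<open>A\<close> because the double integral of the indicator of \<open>x y \<in> A\<close> is \<open>\<mu>(A)\<close> or \<open>\<nu>(A)\<close> according to the
  order of integration (\<open>invariant_measures_agree\<close>). For an uncountable group \<open>B\<close> the topology of \<open>K\<close> has no
  countable base and multiplication need not be measurable for the product of the Borel
  \<open>\<sigma>\<close>-algebras, so Fubini's theorem is applied only to cylinders: sets of characters determined by their
  values at finitely many points. Regularity then carries the result to all Borel sets. Invariance of
  \<open>\<mu>H\<close> under the dual of \<open>\<alpha>\<close> restricted to \<open>H\<close> follows, as \<open>\<mu>H\<close> is an image of \<open>\<mu>\<close>.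

  The second is the density statement (\<open>dilated_subspaces_dense\<close>). The subspace \<open>U(-j,0) W L\<^sup>2\<close> consists of
  the functions that depend on a character only through its restriction to \<open>\<alpha>\<^sup>-\<^sup>j(H)\<close>. These subgroups
  increase to \<open>B\<close>, so the finitely many points that determine a cylinder lie in one of them and the
  indicator of the cylinder belongs to the corresponding subspace. Regularity of \<open>\<mu>\<close> approximates a
  Borel set by an open set, and that by a cylinder squeezed between it and a compact subset
  (\<open>compact_open_cylinder\<close>), and simple functions are dense in \<open>L\<^sup>2\<close>.\<close>


section \<open>Square-integrable functions and their classes\<close>

lemma cmod_add_square_le: "(cmod (a + b))\<^sup>2 \<le> 2 * (cmod a)\<^sup>2 + 2 * (cmod b)\<^sup>2"
proof -
  have "(cmod (a + b))\<^sup>2 \<le> (cmod a + cmod b)\<^sup>2"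
    by (intro power_mono norm_triangle_ineq norm_ge_zero)
  also have "\<dots> \<le> 2 * (cmod a)\<^sup>2 + 2 * (cmod b)\<^sup>2"
    using sum_squares_bound[of "cmod a" "cmod b"] by (simp add: power2_sum)
  finally show ?thesis .
qed

lemma cnj_measurable [measurable]: "cnj \<in> borel_measurable borel"
  by (intro borel_measurable_continuous_onI continuous_intros)

lemma square_integrable_add:
  assumes "f \<in> square_integrable M" "g \<in> square_integrable M"
  shows "(\<lambda>x. f x + g x) \<in> square_integrable M"
proof -
  have [measurable]: "f \<in> borel_measurable M" "g \<in> borel_measurable M"
    using assms by (auto simp: square_integrable_def)
  have "integrable M (\<lambda>x. 2 * (cmod (f x))\<^sup>2 + 2 * (cmod (g x))\<^sup>2)"
    using assms by (auto simp: square_integrable_def)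
  then have "integrable M (\<lambda>x. (cmod (f x + g x))\<^sup>2)"
    by (rule Bochner_Integration.integrable_bound) (auto simp: cmod_add_square_le)
  then show ?thesis
    by (simp add: square_integrable_def)
qed

lemma square_integrable_scale:
  assumes "f \<in> square_integrable M"
  shows "(\<lambda>x. c * f x) \<in> square_integrable M"
  using assms by (auto simp: square_integrable_def norm_mult power_mult_distrib)

lemma square_integrable_diff:
  assumes "f \<in> square_integrable M" "g \<in> square_integrable M"
  shows "(\<lambda>x. f x - g x) \<in> square_integrable M"
  using square_integrable_add[OF assms(1) square_integrable_scale[OF assms(2), of "-1"]] by simp

lemma square_integrable_bounded:
  assumes "finite_measure M" "f \<in> borel_measurable M" "\<And>x. x \<in> space M \<Longrightarrow> cmod (f x) \<le> C"
  shows "f \<in> square_integrable M"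
proof -
  interpret finite_measure M by fact
  have [measurable]: "f \<in> borel_measurable M" by fact
  have "integrable M (\<lambda>x. (cmod (f x))\<^sup>2)"
  proof (rule integrable_const_bound)
    show "AE x in M. norm ((cmod (f x))\<^sup>2) \<le> C\<^sup>2"
      using assms(3) by (auto intro!: AE_I2 power_mono)
  qed simp
  then show ?thesis
    by (simp add: square_integrable_def)
qed

lemma equiv_ae_rel: "equiv (square_integrable M) (ae_rel M)"
proof (rule equivI)
  show "trans (ae_rel M)"
    unfolding trans_def ae_rel_def by auto
qed (auto simp: ae_rel_def refl_on_def sym_def)

lemma l2_class_in_L2: "f \<in> square_integrable M \<Longrightarrow> l2_class M f \<in> L2 M"
  by (simp add: l2_class_def L2_def quotientI)

lemma L2_cases:
  assumes "F \<in> L2 M"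
  obtains f where "f \<in> square_integrable M" "F = l2_class M f"
  using assms by (auto simp: l2_class_def L2_def elim: quotientE)

lemma mem_l2_class:
  "g \<in> l2_class M f \<longleftrightarrow>
     f \<in> square_integrable M \<and> g \<in> square_integrable M \<and> (AE x in M. f x = g x)"
  by (auto simp: l2_class_def ae_rel_def)

lemma l2_class_eqI:
  assumes "f \<in> square_integrable M" "g \<in> square_integrable M" "AE x in M. f x = g x"
  shows "l2_class M f = l2_class M g"
  unfolding l2_class_def
  by (rule equiv_class_eq[OF equiv_ae_rel]) (use assms in \<open>simp add: ae_rel_def\<close>)

lemma l2_class_cong:
  assumes "f \<in> square_integrable M" "\<And>x. x \<in> space M \<Longrightarrow> f x = g x"
  shows "l2_class M f = l2_class M g"
proof (rule l2_class_eqI)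
  show "g \<in> square_integrable M"
    using assms
    by (simp add: square_integrable_def cong: measurable_cong Bochner_Integration.integrable_cong)
qed (use assms in auto)

lemma l2_lift_class:
  assumes "f \<in> square_integrable M"
    and "\<And>f. f \<in> square_integrable M \<Longrightarrow> \<Phi> f \<in> square_integrable N"
    and "\<And>f g. \<lbrakk>f \<in> square_integrable M; g \<in> square_integrable M; AE x in M. f x = g x\<rbrakk>
           \<Longrightarrow> AE x in N. \<Phi> f x = \<Phi> g x"
  shows "l2_lift M N \<Phi> (l2_class M f) = l2_class N (\<Phi> f)"
proof -
  have "l2_class N (\<Phi> f) = l2_class N (\<Phi> g)" if "g \<in> l2_class M f" for g
    using that by (intro l2_class_eqI assms(2,3)) (auto simp: mem_l2_class)
  moreover have "f \<in> l2_class M f"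
    using assms(1) by (simp add: mem_l2_class)
  ultimately show ?thesis
    unfolding l2_lift_def by blast
qed

lemma l2_scale_class:
  assumes "f \<in> square_integrable M"
  shows "l2_scale M c (l2_class M f) = l2_class M (\<lambda>x. c * f x)"
  using l2_lift_class[of f M "\<lambda>f x. c * f x" M] assms
  by (auto simp: l2_lift_def l2_scale_def square_integrable_scale)

lemma l2_add_class:
  assumes "f \<in> square_integrable M" "g \<in> square_integrable M"
  shows "l2_add M (l2_class M f) (l2_class M g) = l2_class M (\<lambda>x. f x + g x)"
proof -
  have "l2_class M (\<lambda>x. f x + g x) = l2_class M (\<lambda>x. f' x + g' x)"
    if "f' \<in> l2_class M f" "g' \<in> l2_class M g" for f' g'
    using that by (intro l2_class_eqI square_integrable_add) (auto simp: mem_l2_class)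
  moreover have "f \<in> l2_class M f" "g \<in> l2_class M g"
    using assms by (simp_all add: mem_l2_class)
  ultimately show ?thesis
    unfolding l2_add_def by blast
qed

lemma l2_inner_class:
  assumes "f \<in> square_integrable M" "g \<in> square_integrable M"
  shows "l2_inner M (l2_class M f) (l2_class M g) = (LINT x|M. f x * cnj (g x))"
proof -
  have "(LINT x|M. f' x * cnj (g' x)) = (LINT x|M. f x * cnj (g x))"
    if "f' \<in> l2_class M f" "g' \<in> l2_class M g" for f' g'
  proof (rule integral_cong_AE)
    have [measurable]: "f \<in> borel_measurable M" "g \<in> borel_measurable M"
      "f' \<in> borel_measurable M" "g' \<in> borel_measurable M"
      using that by (auto simp: mem_l2_class square_integrable_def)
    show "(\<lambda>x. f' x * cnj (g' x)) \<in> borel_measurable M"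
      "(\<lambda>x. f x * cnj (g x)) \<in> borel_measurable M"
      by measurable
    show "AE x in M. f' x * cnj (g' x) = f x * cnj (g x)"
      using that by (auto simp: mem_l2_class)
  qed
  moreover have "f \<in> l2_class M f" "g \<in> l2_class M g"
    using assms by (simp_all add: mem_l2_class)
  ultimately have "(\<Union>f\<in>l2_class M f. \<Union>g\<in>l2_class M g. {LINT x|M. f x * cnj (g x)})
      = {LINT x|M. f x * cnj (g x)}"
    by blast
  then show ?thesis
    by (simp add: l2_inner_def)
qed

lemma l2_norm_class:
  assumes "f \<in> square_integrable M"
  shows "l2_norm M (l2_class M f) = sqrt (LINT x|M. (cmod (f x))\<^sup>2)"
proof -
  have "(LINT x|M. f x * cnj (f x)) = complex_of_real (LINT x|M. (cmod (f x))\<^sup>2)"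
    by (simp only: complex_norm_square[symmetric] integral_complex_of_real)
  then show ?thesis
    using assms by (simp add: l2_norm_def l2_inner_class)
qed


section \<open>Weighted composition operators\<close>

text \<open>All operators of the theorem have the form \<open>f \<mapsto> w \<cdot> (f \<circ> T)\<close> with a weight of modulus one and
  a measure-preserving map, so that well-definedness on classes, linearity and preservation of inner
  products are settled here once and for all. The map \<open>T\<close> goes from the space of the target to the
  space of the source.\<close>

definition weighted_composition ::
    "('c \<Rightarrow> complex) \<Rightarrow> ('c \<Rightarrow> 'a) \<Rightarrow> ('a \<Rightarrow> complex) \<Rightarrow> 'c \<Rightarrow> complex" where
  "weighted_composition w T f = (\<lambda>x. w x * f (T x))"

locale unimodular_composition =
  fixes M :: "'a measure" and N :: "'c measure" and w :: "'c \<Rightarrow> complex" and T :: "'c \<Rightarrow> 'a"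
  assumes T_measurable [measurable]: "T \<in> measurable N M"
    and T_preserving: "distr N M T = M"
    and w_measurable [measurable]: "w \<in> borel_measurable N"
    and w_unimodular: "x \<in> space N \<Longrightarrow> cmod (w x) = 1"
begin

abbreviation act :: "('a \<Rightarrow> complex) \<Rightarrow> 'c \<Rightarrow> complex" where
  "act \<equiv> weighted_composition w T"

lemma act_square_integrable:
  assumes "f \<in> square_integrable M"
  shows "act f \<in> square_integrable N"
proof -
  have [measurable]: "f \<in> borel_measurable M"
    using assms by (simp add: square_integrable_def)
  have "integrable (distr N M T) (\<lambda>x. (cmod (f x))\<^sup>2)"
    using assms by (simp add: T_preserving square_integrable_def)
  then have "integrable N (\<lambda>x. (cmod (f (T x)))\<^sup>2)"
    by (rule integrable_distr[OF T_measurable])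
  then have "integrable N (\<lambda>x. (cmod (w x * f (T x)))\<^sup>2)"
    by (simp add: norm_mult w_unimodular cong: Bochner_Integration.integrable_cong)
  then show ?thesis
    by (simp add: square_integrable_def weighted_composition_def)
qed

lemma act_AE_cong:
  assumes "AE x in M. f x = g x"
  shows "AE x in N. act f x = act g x"
proof -
  have "AE x in distr N M T. f x = g x"
    using assms by (simp only: T_preserving)
  then show ?thesis
    unfolding weighted_composition_def by (auto dest: AE_distrD[OF T_measurable])
qed

lemma lift_class:
  assumes "f \<in> square_integrable M"
  shows "l2_lift M N act (l2_class M f) = l2_class N (act f)"
  using assms by (intro l2_lift_class act_square_integrable act_AE_cong)

lemma integral_act:
  assumes "f \<in> square_integrable M" "g \<in> square_integrable M"
  shows "(LINT x|N. act f x * cnj (act g x)) = (LINT x|M. f x * cnj (g x))"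
proof -
  have [measurable]: "f \<in> borel_measurable M" "g \<in> borel_measurable M"
    using assms by (auto simp: square_integrable_def)
  have "w x * a * cnj (w x * b) = a * cnj b" if "x \<in> space N" for x a b
  proof -
    have "w x * cnj (w x) = 1"
      using w_unimodular[OF that] by (simp add: complex_norm_square[symmetric])
    then show ?thesis
      by (metis complex_cnj_mult mult.assoc mult.left_commute mult_1)
  qed
  then have "(LINT x|N. act f x * cnj (act g x)) = (LINT x|N. f (T x) * cnj (g (T x)))"
    unfolding weighted_composition_def by (intro Bochner_Integration.integral_cong) auto
  also have "\<dots> = (LINT x|distr N M T. f x * cnj (g x))"
    by (subst integral_distr) auto
  finally show ?thesis
    by (simp only: T_preserving)
qed

lemma inner_lift:
  assumes "F \<in> L2 M" "G \<in> L2 M"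
  shows "l2_inner N (l2_lift M N act F) (l2_lift M N act G) = l2_inner M F G"
  using assms
  by (auto elim!: L2_cases simp: lift_class l2_inner_class act_square_integrable integral_act)

lemma lift_in_L2: "F \<in> L2 M \<Longrightarrow> l2_lift M N act F \<in> L2 N"
  by (auto elim!: L2_cases simp: lift_class intro!: l2_class_in_L2 act_square_integrable)

lemma linear_lift: "l2_linear M N (l2_lift M N act)"
proof -
  have add: "act (\<lambda>x. f x + g x) = (\<lambda>x. act f x + act g x)"
    and scale: "act (\<lambda>x. c * f x) = (\<lambda>x. c * act f x)" for f g c
    by (auto simp: weighted_composition_def algebra_simps)
  show ?thesis
    unfolding l2_linear_def
    by (auto elim!: L2_cases simp: lift_in_L2 l2_class_in_L2 lift_class l2_add_class l2_scale_class
        square_integrable_add square_integrable_scale act_square_integrable add scale)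
qed

lemma isometry_lift: "l2_isometry M N (l2_lift M N act)"
  unfolding l2_isometry_def by (auto simp: linear_lift l2_norm_def inner_lift)

end

text \<open>Identities between products of such operators reduce to pointwise identities of weights and
  maps.\<close>

lemma weighted_composition_square:
  assumes wT: "unimodular_composition M N w T" and vS: "unimodular_composition L M v S"
    and wT': "unimodular_composition M' N w' T'" and vS': "unimodular_composition L M' v' S'"
    and F: "F \<in> L2 L"
    and weights: "\<And>x. x \<in> space N \<Longrightarrow> w x * v (T x) = w' x * v' (T' x)"
    and maps: "\<And>x. x \<in> space N \<Longrightarrow> S (T x) = S' (T' x)"
  shows "l2_lift M N (weighted_composition w T) (l2_lift L M (weighted_composition v S) F)
       = l2_lift M' N (weighted_composition w' T') (l2_lift L M' (weighted_composition v' S') F)"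
proof -
  interpret wT: unimodular_composition M N w T by fact
  interpret vS: unimodular_composition L M v S by fact
  interpret wT': unimodular_composition M' N w' T' by fact
  interpret vS': unimodular_composition L M' v' S' by fact
  obtain f where f: "f \<in> square_integrable L" "F = l2_class L f"
    using F by (rule L2_cases)
  have "l2_class N (wT.act (vS.act f)) = l2_class N (wT'.act (vS'.act f))"
    using f weights maps
    by (intro l2_class_cong wT.act_square_integrable vS.act_square_integrable)
       (auto simp: weighted_composition_def mult.assoc[symmetric])
  then show ?thesis
    using f by (simp add: wT.lift_class vS.lift_class wT'.lift_class vS'.lift_class
        vS.act_square_integrable vS'.act_square_integrable)
qed

lemma weighted_composition_identity:
  assumes "unimodular_composition M M w T" "F \<in> L2 M"
    and "\<And>x. x \<in> space M \<Longrightarrow> w x = 1" "\<And>x. x \<in> space M \<Longrightarrow> T x = x"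
  shows "l2_lift M M (weighted_composition w T) F = F"
proof -
  interpret unimodular_composition M M w T by fact
  obtain f where f: "f \<in> square_integrable M" "F = l2_class M f"
    using assms(2) by (rule L2_cases)
  have "l2_class M f = l2_class M (act f)"
    using f assms(3,4) by (intro l2_class_cong) (auto simp: weighted_composition_def)
  then show ?thesis
    using f lift_class by metis
qed

lemma unimodular_composition_identity: "unimodular_composition M M (\<lambda>x. 1) (\<lambda>x. x)"
  by unfold_locales (auto simp: distr_id2)

lemma weighted_composition_triangle:
  assumes wT: "unimodular_composition M N w T" and vS: "unimodular_composition L M v S"
    and wT': "unimodular_composition L N w' T'" and F: "F \<in> L2 L"
    and "\<And>x. x \<in> space N \<Longrightarrow> w x * v (T x) = w' x" "\<And>x. x \<in> space N \<Longrightarrow> S (T x) = T' x"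
  shows "l2_lift M N (weighted_composition w T) (l2_lift L M (weighted_composition v S) F)
       = l2_lift L N (weighted_composition w' T') F"
  using weighted_composition_square[OF wT vS wT' unimodular_composition_identity F] assms(5,6)
    weighted_composition_identity[OF unimodular_composition_identity F] by simp

lemma weighted_composition_unitary:
  assumes wT: "unimodular_composition M M w T" and vS: "unimodular_composition M M v S"
    and "\<And>x. x \<in> space M \<Longrightarrow> w x * v (T x) = 1" "\<And>x. x \<in> space M \<Longrightarrow> S (T x) = x"
    and "\<And>x. x \<in> space M \<Longrightarrow> v x * w (S x) = 1" "\<And>x. x \<in> space M \<Longrightarrow> T (S x) = x"
  shows "l2_unitary M (l2_lift M M (weighted_composition w T))"
proof -
  interpret wT: unimodular_composition M M w T by fact
  interpret vS: unimodular_composition M M v S by fact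
  let ?W = "l2_lift M M wT.act" and ?V = "l2_lift M M vS.act"
  have WV: "?W (?V F) = F" and VW: "?V (?W F) = F" if "F \<in> L2 M" for F
    using weighted_composition_triangle[OF wT vS unimodular_composition_identity that]
      weighted_composition_triangle[OF vS wT unimodular_composition_identity that]
      weighted_composition_identity[OF unimodular_composition_identity that] assms(3-6)
    by simp_all
  have "bij_betw ?W (L2 M) (L2 M)"
    by (rule bij_betwI[where g = ?V]) (auto simp: wT.lift_in_L2 vS.lift_in_L2 WV VW)
  then show ?thesis
    by (simp add: l2_unitary_def wT.linear_lift wT.inner_lift)
qed


section \<open>Density in the space of square-integrable functions\<close>

text \<open>Distances are kept squared: \<open>\<bar>a + b\<bar>\<^sup>2 \<le> 2 \<bar>a\<bar>\<^sup>2 + 2 \<bar>b\<bar>\<^sup>2\<close> then integrates to a substitute for the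
  triangle inequality.\<close>

definition l2_approximable :: "'a measure \<Rightarrow> ('a \<Rightarrow> complex) set \<Rightarrow> ('a \<Rightarrow> complex) \<Rightarrow> bool" where
  "l2_approximable M S f \<longleftrightarrow> (\<forall>e>0. \<exists>g\<in>S. (LINT x|M. (cmod (f x - g x))\<^sup>2) < e)"

lemma integral_cmod_add_square_le:
  assumes "f \<in> square_integrable M" "g \<in> square_integrable M"
  shows "(LINT x|M. (cmod (f x + g x))\<^sup>2)
           \<le> 2 * (LINT x|M. (cmod (f x))\<^sup>2) + 2 * (LINT x|M. (cmod (g x))\<^sup>2)"
proof -
  have int: "integrable M (\<lambda>x. (cmod (f x))\<^sup>2)" "integrable M (\<lambda>x. (cmod (g x))\<^sup>2)"
    "integrable M (\<lambda>x. (cmod (f x + g x))\<^sup>2)"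
    using assms square_integrable_add[OF assms] by (auto simp: square_integrable_def)
  have "(LINT x|M. (cmod (f x + g x))\<^sup>2) \<le> (LINT x|M. 2 * (cmod (f x))\<^sup>2 + 2 * (cmod (g x))\<^sup>2)"
    using int by (intro integral_mono) (auto simp: cmod_add_square_le)
  also have "\<dots> = 2 * (LINT x|M. (cmod (f x))\<^sup>2) + 2 * (LINT x|M. (cmod (g x))\<^sup>2)"
    using int by simp
  finally show ?thesis .
qed

lemma l2_approximable_trans:
  assumes "S \<subseteq> square_integrable M" "f \<in> square_integrable M"
    and "\<And>e. e > 0 \<Longrightarrow> \<exists>g\<in>square_integrable M.
           l2_approximable M S g \<and> (LINT x|M. (cmod (f x - g x))\<^sup>2) < e"
  shows "l2_approximable M S f"
  unfolding l2_approximable_def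
proof (intro allI impI)
  fix e :: real assume "e > 0"
  then obtain g where g: "g \<in> square_integrable M" "l2_approximable M S g"
    and fg: "(LINT x|M. (cmod (f x - g x))\<^sup>2) < e / 4"
    using assms(3)[of "e / 4"] by auto
  then obtain h where h: "h \<in> S" and gh: "(LINT x|M. (cmod (g x - h x))\<^sup>2) < e / 4"
    using \<open>e > 0\<close> by (auto simp: l2_approximable_def dest: spec[of _ "e / 4"])
  have "(LINT x|M. (cmod (f x - h x))\<^sup>2) = (LINT x|M. (cmod ((f x - g x) + (g x - h x)))\<^sup>2)"
    by simp
  also have "\<dots> \<le> 2 * (LINT x|M. (cmod (f x - g x))\<^sup>2) + 2 * (LINT x|M. (cmod (g x - h x))\<^sup>2)"
    using g h assms(1,2) by (intro integral_cmod_add_square_le square_integrable_diff) auto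
  also have "\<dots> < e"
    using fg gh by simp
  finally show "\<exists>g\<in>S. (LINT x|M. (cmod (f x - g x))\<^sup>2) < e"
    using h by blast
qed

lemma l2_approximable_add:
  assumes "S \<subseteq> square_integrable M" "\<And>g h. \<lbrakk>g \<in> S; h \<in> S\<rbrakk> \<Longrightarrow> (\<lambda>x. g x + h x) \<in> S"
    and "f \<in> square_integrable M" "f' \<in> square_integrable M"
    and "l2_approximable M S f" "l2_approximable M S f'"
  shows "l2_approximable M S (\<lambda>x. f x + f' x)"
  unfolding l2_approximable_def
proof (intro allI impI)
  fix e :: real assume "e > 0"
  then obtain g g' where g: "g \<in> S" "g' \<in> S"
    and fg: "(LINT x|M. (cmod (f x - g x))\<^sup>2) < e / 4" "(LINT x|M. (cmod (f' x - g' x))\<^sup>2) < e / 4"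
    using assms(5,6) unfolding l2_approximable_def by (meson divide_pos_pos zero_less_numeral)
  have "(LINT x|M. (cmod (f x + f' x - (g x + g' x)))\<^sup>2)
      = (LINT x|M. (cmod ((f x - g x) + (f' x - g' x)))\<^sup>2)"
    by (simp add: algebra_simps)
  also have "\<dots> \<le> 2 * (LINT x|M. (cmod (f x - g x))\<^sup>2) + 2 * (LINT x|M. (cmod (f' x - g' x))\<^sup>2)"
    using g assms(1,3,4) by (intro integral_cmod_add_square_le square_integrable_diff) auto
  also have "\<dots> < e"
    using fg by simp
  finally show "\<exists>h\<in>S. (LINT x|M. (cmod (f x + f' x - h x))\<^sup>2) < e"
    by (rule bexI[OF _ assms(2)[OF g]])
qed

lemma l2_approximable_scale:
  assumes "\<And>g c. g \<in> S \<Longrightarrow> (\<lambda>x. c * g x) \<in> S" and "l2_approximable M S f"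
  shows "l2_approximable M S (\<lambda>x. c * f x)"
  unfolding l2_approximable_def
proof (intro allI impI)
  fix e :: real assume "e > 0"
  define k where "k = (cmod c)\<^sup>2 + 1"
  have "k > 0" unfolding k_def by (simp add: add_nonneg_pos)
  then obtain g where g: "g \<in> S" and fg: "(LINT x|M. (cmod (f x - g x))\<^sup>2) < e / k"
    using assms(2) \<open>e > 0\<close> unfolding l2_approximable_def by (meson divide_pos_pos)
  have "(LINT x|M. (cmod (c * f x - c * g x))\<^sup>2) = (cmod c)\<^sup>2 * (LINT x|M. (cmod (f x - g x))\<^sup>2)"
    by (simp add: right_diff_distrib[symmetric] norm_mult power_mult_distrib)
  also have "\<dots> \<le> k * (LINT x|M. (cmod (f x - g x))\<^sup>2)"
    by (intro mult_right_mono) (auto simp: k_def)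
  also have "\<dots> < e"
    using fg \<open>k > 0\<close> by (simp add: field_simps)
  finally show "\<exists>h\<in>S. (LINT x|M. (cmod (c * f x - h x))\<^sup>2) < e"
    by (rule bexI[OF _ assms(1)[OF g]])
qed

lemma l2_approximable_sum:
  assumes "finite Y" "S \<subseteq> square_integrable M" "(\<lambda>x. 0) \<in> S"
    and "\<And>g h. \<lbrakk>g \<in> S; h \<in> S\<rbrakk> \<Longrightarrow> (\<lambda>x. g x + h x) \<in> S"
    and "\<And>y. y \<in> Y \<Longrightarrow> f y \<in> square_integrable M \<and> l2_approximable M S (f y)"
  shows "(\<lambda>x. \<Sum>y\<in>Y. f y x) \<in> square_integrable M \<and> l2_approximable M S (\<lambda>x. \<Sum>y\<in>Y. f y x)"
  using assms(1,5)
proof (induction Y rule: finite_induct)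
  case empty
  have "(\<lambda>x. 0) \<in> square_integrable M"
    by (simp add: square_integrable_def)
  moreover have "l2_approximable M S (\<lambda>x. 0)"
    unfolding l2_approximable_def
  proof (intro allI impI)
    fix e :: real assume "e > 0"
    then show "\<exists>g\<in>S. (LINT x|M. (cmod (0 - g x))\<^sup>2) < e"
      by (intro bexI[OF _ assms(3)]) simp
  qed
  ultimately show ?case by simp
next
  case (insert y Y)
  have y: "f y \<in> square_integrable M" "l2_approximable M S (f y)"
    using insert.prems by simp_all
  have Y: "(\<lambda>x. \<Sum>y\<in>Y. f y x) \<in> square_integrable M"
    "l2_approximable M S (\<lambda>x. \<Sum>y\<in>Y. f y x)"
    using insert.IH insert.prems by simp_all
  have "(\<lambda>x. f y x + (\<Sum>y\<in>Y. f y x)) \<in> square_integrable M"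
    by (rule square_integrable_add) (fact y Y)+
  moreover have "l2_approximable M S (\<lambda>x. f y x + (\<Sum>y\<in>Y. f y x))"
    by (rule l2_approximable_add[OF assms(2,4)]) (assumption | fact y Y)+
  ultimately show ?case
    using insert.hyps by simp
qed

lemma l2_dense_mono:
  "\<lbrakk>l2_dense M S; S \<subseteq> S'; S' \<subseteq> L2 M\<rbrakk> \<Longrightarrow> l2_dense M S'"
  unfolding l2_dense_def by (meson subsetD)

text \<open>Simple functions are dense in the square-integrable ones, by dominated convergence, and they
  are linear combinations of indicators.\<close>

lemma l2_dense_if_indicators_approximable:
  assumes "finite_measure M" "S \<subseteq> square_integrable M" "(\<lambda>x. 0) \<in> S"
    and add: "\<And>g h. \<lbrakk>g \<in> S; h \<in> S\<rbrakk> \<Longrightarrow> (\<lambda>x. g x + h x) \<in> S"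
    and scale: "\<And>g c. g \<in> S \<Longrightarrow> (\<lambda>x. c * g x) \<in> S"
    and indicators: "\<And>A. A \<in> sets M \<Longrightarrow> l2_approximable M S (indicator A)"
  shows "l2_dense M (l2_class M ` S)"
proof -
  interpret finite_measure M by fact
  have simple: "s \<in> square_integrable M \<and> l2_approximable M S s" if s: "simple_function M s" for s
  proof -
    have [measurable]: "s \<in> borel_measurable M"
      using s by (rule borel_measurable_simple_function)
    have fin: "finite (s ` space M)"
      using s by (rule simple_functionD)
    define t where "t = (\<lambda>x. \<Sum>y\<in>s ` space M. y * indicator (s -` {y} \<inter> space M) x)"
    have st: "s x = t x" if "x \<in> space M" for x
    proof -
      have "t x = (\<Sum>y\<in>s ` space M. if y = s x then y else 0)"
        unfolding t_def using that by (intro sum.cong) (auto simp: indicator_def)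
      then show ?thesis
        using fin that by simp
    qed
    have "indicator (s -` {y} \<inter> space M) \<in> square_integrable M" for y
      by (rule square_integrable_bounded[where C = 1]) (auto simp: indicator_def finite_measure_axioms)
    moreover have "l2_approximable M S (indicator (s -` {y} \<inter> space M))" for y
      by (intro indicators) measurable
    ultimately have "t \<in> square_integrable M \<and> l2_approximable M S t"
      unfolding t_def using assms(2,3) fin
      by (intro l2_approximable_sum add conjI square_integrable_scale l2_approximable_scale scale)
    moreover have "s \<in> square_integrable M \<longleftrightarrow> t \<in> square_integrable M"
      using st by (simp add: square_integrable_def cong: measurable_cong Bochner_Integration.integrable_cong)
    moreover have "l2_approximable M S s \<longleftrightarrow> l2_approximable M S t"
      using st by (simp add: l2_approximable_def cong: Bochner_Integration.integral_cong)
    ultimately show ?thesis by simp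
  qed
  have approximable: "l2_approximable M S f" if f: "f \<in> square_integrable M" for f
  proof (rule l2_approximable_trans[OF assms(2) f])
    fix e :: real assume "e > 0"
    have fm [measurable]: "f \<in> borel_measurable M"
      using f by (simp add: square_integrable_def)
    obtain s where s: "\<And>i. simple_function M (s i)"
      and lim: "\<And>x. x \<in> space M \<Longrightarrow> (\<lambda>i. s i x) \<longlonglongrightarrow> f x"
      and bound: "\<And>i x. x \<in> space M \<Longrightarrow> cmod (s i x) \<le> 2 * cmod (f x)"
      using borel_measurable_implies_sequence_metric[OF fm, of 0] by (simp add: dist_norm) metis
    have [measurable]: "s i \<in> borel_measurable M" for i
      using s by (rule borel_measurable_simple_function)
    have "(\<lambda>i. LINT x|M. (cmod (f x - s i x))\<^sup>2) \<longlonglongrightarrow> (LINT x|M. 0)"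
      \<comment> \<open>\<open>10 = 2 + 2 \<cdot> 2\<^sup>2\<close>, because the approximating simple functions are bounded by \<open>2 \<bar>f\<bar>\<close>.\<close>
    proof (rule integral_dominated_convergence[where w = "\<lambda>x. 10 * (cmod (f x))\<^sup>2"])
      show "integrable M (\<lambda>x. 10 * (cmod (f x))\<^sup>2)"
        using f by (simp add: square_integrable_def)
      show "AE x in M. (\<lambda>i. (cmod (f x - s i x))\<^sup>2) \<longlonglongrightarrow> 0"
      proof (rule AE_I2)
        fix x assume "x \<in> space M"
        then have "(\<lambda>i. (cmod (f x - s i x))\<^sup>2) \<longlonglongrightarrow> (cmod (f x - f x))\<^sup>2"
          by (intro tendsto_intros lim)
        then show "(\<lambda>i. (cmod (f x - s i x))\<^sup>2) \<longlonglongrightarrow> 0" by simp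
      qed
      fix i
      show "AE x in M. norm ((cmod (f x - s i x))\<^sup>2) \<le> 10 * (cmod (f x))\<^sup>2"
      proof (rule AE_I2)
        fix x assume "x \<in> space M"
        then have "(cmod (s i x))\<^sup>2 \<le> (2 * cmod (f x))\<^sup>2"
          by (intro power_mono bound) auto
        then show "norm ((cmod (f x - s i x))\<^sup>2) \<le> 10 * (cmod (f x))\<^sup>2"
          using cmod_add_square_le[of "f x" "- s i x"] by (simp add: power_mult_distrib)
      qed
    qed auto
    then have "(\<lambda>i. LINT x|M. (cmod (f x - s i x))\<^sup>2) \<longlonglongrightarrow> 0" by simp
    then have "\<forall>\<^sub>F i in sequentially. (LINT x|M. (cmod (f x - s i x))\<^sup>2) < e"
      using \<open>e > 0\<close> by (rule order_tendstoD)
    then obtain i where "(LINT x|M. (cmod (f x - s i x))\<^sup>2) < e"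
      by (auto dest: eventually_happens)
    then show "\<exists>g\<in>square_integrable M. l2_approximable M S g \<and> (LINT x|M. (cmod (f x - g x))\<^sup>2) < e"
      using simple[OF s[of i]] by blast
  qed
  show ?thesis
    unfolding l2_dense_def
  proof (intro conjI ballI allI impI)
    show "l2_class M ` S \<subseteq> L2 M"
      using assms(2) l2_class_in_L2 by blast
    fix F and e :: real assume "F \<in> L2 M" "e > 0"
    then obtain f where f: "f \<in> square_integrable M" "F = l2_class M f"
      by (auto elim: L2_cases)
    then obtain g where g: "g \<in> S" and fg: "(LINT x|M. (cmod (f x - g x))\<^sup>2) < e\<^sup>2"
      using approximable[OF f(1)] \<open>e > 0\<close> unfolding l2_approximable_def by (meson zero_less_power)
    have "g \<in> square_integrable M" using g assms(2) by auto
    then have "l2_norm M (l2_add M F (l2_scale M (-1) (l2_class M g)))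
        = sqrt (LINT x|M. (cmod (f x - g x))\<^sup>2)"
      using f square_integrable_scale[of g M "-1"] square_integrable_diff[of f M g]
      by (simp add: l2_scale_class l2_add_class l2_norm_class)
    also have "\<dots> < sqrt (e\<^sup>2)"
      using fg by (rule real_sqrt_less_mono)
    finally show "\<exists>G\<in>l2_class M ` S. l2_norm M (l2_add M F (l2_scale M (-1) G)) < e"
      using g \<open>e > 0\<close> by auto
  qed
qed


section \<open>Dual groups and dual maps\<close>

lemma carrier_dual_group:
  "\<xi> \<in> carrier (dual_group B) \<longleftrightarrow>
     \<xi> \<in> extensional (carrier B) \<and> (\<forall>b\<in>carrier B. cmod (\<xi> b) = 1) \<and>
     (\<forall>a\<in>carrier B. \<forall>b\<in>carrier B. \<xi> (a \<otimes>\<^bsub>B\<^esub> b) = \<xi> a * \<xi> b)"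
  by (auto simp: dual_group_def circle_group_def hom_def Pi_iff)

lemma character_norm: "\<lbrakk>\<xi> \<in> carrier (dual_group B); b \<in> carrier B\<rbrakk> \<Longrightarrow> cmod (\<xi> b) = 1"
  by (simp add: carrier_dual_group)

lemma character_mult:
  "\<lbrakk>\<xi> \<in> carrier (dual_group B); a \<in> carrier B; b \<in> carrier B\<rbrakk>
     \<Longrightarrow> \<xi> (a \<otimes>\<^bsub>B\<^esub> b) = \<xi> a * \<xi> b"
  by (simp add: carrier_dual_group)

lemma character_eqI:
  assumes "\<xi> \<in> carrier (dual_group B)" "\<psi> \<in> carrier (dual_group B)"
    and "\<And>b. b \<in> carrier B \<Longrightarrow> \<xi> b = \<psi> b"
  shows "\<xi> = \<psi>"
  using assms by (intro extensionalityI[of _ "carrier B"]) (auto simp: carrier_dual_group)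

lemma (in group) character_one:
  assumes "\<xi> \<in> carrier (dual_group G)"
  shows "\<xi> \<one> = 1"
proof -
  have "\<xi> \<one> * \<xi> \<one> = \<xi> \<one>"
    using character_mult[OF assms, of \<one> \<one>] by simp
  moreover have "\<xi> \<one> \<noteq> 0"
    using character_norm[OF assms, of \<one>] by auto
  ultimately show ?thesis by simp
qed

lemma mult_dual_group: "\<xi> \<otimes>\<^bsub>dual_group B\<^esub> \<psi> = (\<lambda>b\<in>carrier B. \<xi> b * \<psi> b)"
  by (simp add: dual_group_def)

lemma one_dual_group: "\<one>\<^bsub>dual_group B\<^esub> = (\<lambda>b\<in>carrier B. 1)"
  by (simp add: dual_group_def)

lemma (in group) comm_group_dual: "comm_group (dual_group G)"
proof (rule comm_groupI)
  fix x assume x: "x \<in> carrier (dual_group G)"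
  have "(\<lambda>b\<in>carrier G. cnj (x b)) \<in> carrier (dual_group G)"
    using x by (auto simp: carrier_dual_group)
  moreover have "(\<lambda>b\<in>carrier G. cnj (x b)) \<otimes>\<^bsub>dual_group G\<^esub> x = \<one>\<^bsub>dual_group G\<^esub>"
    using character_norm[OF x]
    by (auto simp: mult_dual_group one_dual_group fun_eq_iff restrict_def mult.commute[of "cnj _"]
        complex_norm_square[symmetric])
  ultimately show "\<exists>y\<in>carrier (dual_group G). y \<otimes>\<^bsub>dual_group G\<^esub> x = \<one>\<^bsub>dual_group G\<^esub>"
    by blast
next
  fix x assume x: "x \<in> carrier (dual_group G)"
  then show "\<one>\<^bsub>dual_group G\<^esub> \<otimes>\<^bsub>dual_group G\<^esub> x = x"
    by (auto simp: mult_dual_group one_dual_group fun_eq_iff carrier_dual_group extensional_def)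
qed (auto simp: mult_dual_group one_dual_group carrier_dual_group norm_mult fun_eq_iff mult_ac)

lemma dual_map_apply:
  "\<lbrakk>\<xi> \<in> carrier (dual_group B); a \<in> carrier A\<rbrakk> \<Longrightarrow> dual_map A B \<phi> \<xi> a = \<xi> (\<phi> a)"
  by (simp add: dual_map_def)

lemma dual_map_closed:
  assumes "group A" "\<phi> \<in> hom A B" "\<xi> \<in> carrier (dual_group B)"
  shows "dual_map A B \<phi> \<xi> \<in> carrier (dual_group A)"
proof -
  interpret group A by fact
  show ?thesis
    using assms(2,3) by (auto simp: dual_map_def carrier_dual_group hom_def Pi_iff)
qed

lemma dual_map_dual_map:
  assumes "group A" "group B" "\<phi> \<in> hom A B" "\<psi> \<in> hom B C" "\<xi> \<in> carrier (dual_group C)"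
    and "\<And>a. a \<in> carrier A \<Longrightarrow> \<psi> (\<phi> a) = \<eta> a"
  shows "dual_map A B \<phi> (dual_map B C \<psi> \<xi>) = dual_map A C \<eta> \<xi>"
proof -
  have "dual_map B C \<psi> \<xi> \<in> carrier (dual_group B)"
    by (rule dual_map_closed) fact+
  moreover have "\<phi> a \<in> carrier B" if "a \<in> carrier A" for a
    using that assms(3) by (auto simp: hom_def)
  ultimately show ?thesis
    using assms(5,6) by (auto simp: dual_map_def)
qed

lemma dual_map_identity:
  "\<lbrakk>\<xi> \<in> carrier (dual_group B); \<And>b. b \<in> carrier B \<Longrightarrow> \<phi> b = b\<rbrakk> \<Longrightarrow> dual_map B B \<phi> \<xi> = \<xi>"
  by (auto simp: dual_map_def carrier_dual_group extensional_def restrict_def fun_eq_iff)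

lemma dual_map_mult:
  assumes "group A" "group B" "\<phi> \<in> hom A B"
    and "\<xi> \<in> carrier (dual_group B)" "\<psi> \<in> carrier (dual_group B)"
  shows "dual_map A B \<phi> (\<xi> \<otimes>\<^bsub>dual_group B\<^esub> \<psi>)
           = dual_map A B \<phi> \<xi> \<otimes>\<^bsub>dual_group A\<^esub> dual_map A B \<phi> \<psi>"
proof -
  interpret dual: comm_group "dual_group B"
    using assms(2) by (rule group.comm_group_dual)
  show ?thesis
    using assms(3-5) dual.m_closed[OF assms(4,5)]
    by (auto simp: dual_map_def mult_dual_group hom_def fun_eq_iff restrict_def)
qed

context group
begin

lemma auto_hom: "\<alpha> \<in> auto G \<Longrightarrow> \<alpha> \<in> hom G G"
  by (simp add: auto_def)

lemma auto_closed: "\<lbrakk>\<alpha> \<in> auto G; b \<in> carrier G\<rbrakk> \<Longrightarrow> \<alpha> b \<in> carrier G"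
  by (auto simp: auto_def hom_def)

lemma carrier_AutoGroup: "carrier (AutoGroup G) = auto G"
  by (simp add: AutoGroup_def)

lemma mult_AutoGroup:
  "\<lbrakk>\<alpha> \<in> auto G; \<beta> \<in> auto G\<rbrakk> \<Longrightarrow> \<alpha> \<otimes>\<^bsub>AutoGroup G\<^esub> \<beta> = compose (carrier G) \<alpha> \<beta>"
  by (simp add: AutoGroup_def BijGroup_def auto_def)

lemma one_AutoGroup: "\<one>\<^bsub>AutoGroup G\<^esub> = (\<lambda>b\<in>carrier G. b)"
  by (simp add: AutoGroup_def BijGroup_def)

lemma auto_pow: "\<alpha> \<in> auto G \<Longrightarrow> \<alpha> [^]\<^bsub>AutoGroup G\<^esub> (j::int) \<in> auto G"
  using group.int_pow_closed[OF AutoGroup, of \<alpha> j] by (simp add: carrier_AutoGroup)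

lemma auto_pow_add:
  assumes "\<alpha> \<in> auto G" "b \<in> carrier G"
  shows "(\<alpha> [^]\<^bsub>AutoGroup G\<^esub> (i + j :: int)) b
           = (\<alpha> [^]\<^bsub>AutoGroup G\<^esub> i) ((\<alpha> [^]\<^bsub>AutoGroup G\<^esub> j) b)"
  using group.int_pow_mult[OF AutoGroup, of \<alpha> i j] assms
  by (simp add: carrier_AutoGroup mult_AutoGroup auto_pow compose_def)

lemma auto_pow_one: "\<alpha> \<in> auto G \<Longrightarrow> \<alpha> [^]\<^bsub>AutoGroup G\<^esub> (1::int) = \<alpha>"
  using group.int_pow_1[OF AutoGroup, of \<alpha>] by (simp add: carrier_AutoGroup)

lemma auto_pow_zero: "b \<in> carrier G \<Longrightarrow> (\<alpha> [^]\<^bsub>AutoGroup G\<^esub> (0::int)) b = b"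
  by (simp add: one_AutoGroup)

lemma dual_aut_closed:
  "\<lbrakk>\<alpha> \<in> auto G; \<xi> \<in> carrier (dual_group G)\<rbrakk> \<Longrightarrow> dual_aut G \<alpha> \<xi> \<in> carrier (dual_group G)"
  unfolding dual_aut_def by (intro dual_map_closed group_axioms auto_hom)

lemma dual_aut_dual_aut:
  assumes "\<alpha> \<in> auto G" "\<beta> \<in> auto G" "\<xi> \<in> carrier (dual_group G)"
  shows "dual_aut G \<alpha> (dual_aut G \<beta> \<xi>) = dual_aut G (\<beta> \<otimes>\<^bsub>AutoGroup G\<^esub> \<alpha>) \<xi>"
  unfolding dual_aut_def using assms
  by (intro dual_map_dual_map group_axioms auto_hom) (simp_all add: mult_AutoGroup compose_def)

lemma dual_aut_in_auto:
  assumes "\<alpha> \<in> auto G"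
  shows "dual_aut G \<alpha> \<in> auto (dual_group G)"
proof -
  let ?K = "carrier (dual_group G)"
  define \<beta> where "\<beta> = inv\<^bsub>AutoGroup G\<^esub> \<alpha>"
  have \<beta>: "\<beta> \<in> auto G" "\<beta> \<otimes>\<^bsub>AutoGroup G\<^esub> \<alpha> = \<one>\<^bsub>AutoGroup G\<^esub>" "\<alpha> \<otimes>\<^bsub>AutoGroup G\<^esub> \<beta> = \<one>\<^bsub>AutoGroup G\<^esub>"
    using group.inv_closed[OF AutoGroup, of \<alpha>] group.l_inv[OF AutoGroup, of \<alpha>]
      group.r_inv[OF AutoGroup, of \<alpha>] assms
    by (simp_all add: \<beta>_def carrier_AutoGroup)
  have one: "dual_aut G \<one>\<^bsub>AutoGroup G\<^esub> \<xi> = \<xi>" if "\<xi> \<in> ?K" for \<xi>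
    unfolding dual_aut_def by (rule dual_map_identity[OF that]) (simp add: one_AutoGroup)
  have "bij_betw (dual_aut G \<alpha>) ?K ?K"
    by (rule bij_betwI[where g = "dual_aut G \<beta>"])
       (auto simp: dual_aut_closed assms \<beta> dual_aut_dual_aut one)
  moreover have "dual_aut G \<alpha> \<in> extensional ?K"
    by (simp add: dual_aut_def dual_map_def)
  moreover have "dual_aut G \<alpha> \<in> hom (dual_group G) (dual_group G)"
  proof (rule homI)
    fix \<xi> \<psi> assume "\<xi> \<in> ?K" "\<psi> \<in> ?K"
    then show "dual_aut G \<alpha> (\<xi> \<otimes>\<^bsub>dual_group G\<^esub> \<psi>)
        = dual_aut G \<alpha> \<xi> \<otimes>\<^bsub>dual_group G\<^esub> dual_aut G \<alpha> \<psi>"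
      unfolding dual_aut_def by (intro dual_map_mult group_axioms auto_hom assms)
  qed (simp add: dual_aut_closed assms)
  ultimately show ?thesis
    by (simp add: auto_def Bij_def)
qed

text \<open>Dualizing reverses products, but the powers of one automorphism commute, so no sign appears.\<close>

lemma dual_aut_int_pow:
  assumes "\<alpha> \<in> auto G"
  shows "dual_aut G \<alpha> [^]\<^bsub>AutoGroup (dual_group G)\<^esub> (j::int) = dual_aut G (\<alpha> [^]\<^bsub>AutoGroup G\<^esub> j)"
proof -
  interpret dual: comm_group "dual_group G" by (rule comm_group_dual)
  interpret A: group "AutoGroup G" by (rule AutoGroup)
  interpret D: group "AutoGroup (dual_group G)" by (rule dual.AutoGroup)
  have antihom: "dual_aut G \<beta> \<otimes>\<^bsub>AutoGroup (dual_group G)\<^esub> dual_aut G \<gamma>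
      = dual_aut G (\<gamma> \<otimes>\<^bsub>AutoGroup G\<^esub> \<beta>)" if "\<beta> \<in> auto G" "\<gamma> \<in> auto G" for \<beta> \<gamma>
  proof -
    have "compose (carrier (dual_group G)) (dual_aut G \<beta>) (dual_aut G \<gamma>)
        = restrict (dual_aut G (\<gamma> \<otimes>\<^bsub>AutoGroup G\<^esub> \<beta>)) (carrier (dual_group G))"
      using that by (auto simp: compose_def dual_aut_dual_aut)
    also have "\<dots> = dual_aut G (\<gamma> \<otimes>\<^bsub>AutoGroup G\<^esub> \<beta>)"
      by (rule extensional_restrict) (simp add: dual_aut_def dual_map_def)
    finally show ?thesis
      using that by (simp add: dual.mult_AutoGroup dual_aut_in_auto)
  qed
  have one: "dual_aut G \<one>\<^bsub>AutoGroup G\<^esub> = \<one>\<^bsub>AutoGroup (dual_group G)\<^esub>"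
  proof (rule extensionalityI[of _ "carrier (dual_group G)"])
    fix \<xi> assume "\<xi> \<in> carrier (dual_group G)"
    then show "dual_aut G \<one>\<^bsub>AutoGroup G\<^esub> \<xi> = \<one>\<^bsub>AutoGroup (dual_group G)\<^esub> \<xi>"
      unfolding dual_aut_def
      by (subst dual_map_identity) (simp_all add: one_AutoGroup dual.one_AutoGroup)
  qed (simp_all add: dual_aut_def dual_map_def dual.one_AutoGroup)
  have nat: "dual_aut G \<alpha> [^]\<^bsub>AutoGroup (dual_group G)\<^esub> n = dual_aut G (\<alpha> [^]\<^bsub>AutoGroup G\<^esub> n)"
    for n :: nat
  proof (induction n)
    case 0
    then show ?case by (simp add: one)
  next
    case (Suc n)
    have "\<alpha> [^]\<^bsub>AutoGroup G\<^esub> n \<in> auto G"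
      using A.nat_pow_closed[of \<alpha> n] assms by (simp add: carrier_AutoGroup)
    then show ?case
      using Suc A.nat_pow_Suc2[of \<alpha> n] assms
      by (simp add: antihom carrier_AutoGroup del: A.nat_pow_Suc)
  qed
  have inv: "inv\<^bsub>AutoGroup (dual_group G)\<^esub> (dual_aut G \<beta>) = dual_aut G (inv\<^bsub>AutoGroup G\<^esub> \<beta>)"
    if \<beta>: "\<beta> \<in> auto G" for \<beta>
  proof (rule D.inv_equality)
    have inv: "inv\<^bsub>AutoGroup G\<^esub> \<beta> \<in> auto G"
      using \<beta> A.inv_closed by (simp add: carrier_AutoGroup)
    have "dual_aut G (inv\<^bsub>AutoGroup G\<^esub> \<beta>) \<otimes>\<^bsub>AutoGroup (dual_group G)\<^esub> dual_aut G \<beta>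
        = dual_aut G (\<beta> \<otimes>\<^bsub>AutoGroup G\<^esub> inv\<^bsub>AutoGroup G\<^esub> \<beta>)"
      by (rule antihom[OF inv \<beta>])
    also have "\<beta> \<otimes>\<^bsub>AutoGroup G\<^esub> inv\<^bsub>AutoGroup G\<^esub> \<beta> = \<one>\<^bsub>AutoGroup G\<^esub>"
      using \<beta> by (intro A.r_inv) (simp add: carrier_AutoGroup)
    finally show "dual_aut G (inv\<^bsub>AutoGroup G\<^esub> \<beta>) \<otimes>\<^bsub>AutoGroup (dual_group G)\<^esub> dual_aut G \<beta>
        = \<one>\<^bsub>AutoGroup (dual_group G)\<^esub>"
      by (simp only: one)
    show "dual_aut G \<beta> \<in> carrier (AutoGroup (dual_group G))"
      "dual_aut G (inv\<^bsub>AutoGroup G\<^esub> \<beta>) \<in> carrier (AutoGroup (dual_group G))"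
      using \<beta> inv by (simp_all add: dual.carrier_AutoGroup dual_aut_in_auto)
  qed
  have "\<alpha> [^]\<^bsub>AutoGroup G\<^esub> nat (- j) \<in> auto G"
    using A.nat_pow_closed[of \<alpha> "nat (- j)"] assms by (simp only: carrier_AutoGroup)
  then show ?thesis
    unfolding int_pow_def2 by (simp only: nat inv split: if_split) blast
qed

end


section \<open>The topology and the Borel sets of a dual group\<close>

lemma topspace_dual_topology: "topspace (dual_topology B) = carrier (dual_group B)"
  by (auto simp: dual_topology_def carrier_dual_group PiE_def)

lemma continuous_map_evaluation:
  "b \<in> carrier B \<Longrightarrow> continuous_map (dual_topology B) euclidean (\<lambda>\<xi>. \<xi> b)"
  unfolding dual_topology_def
  by (intro continuous_map_from_subtopology continuous_map_product_projection)

lemma continuous_map_dual_map: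
  assumes "group A" "\<phi> \<in> hom A B"
  shows "continuous_map (dual_topology B) (dual_topology A) (dual_map A B \<phi>)"
proof -
  have "continuous_map (dual_topology B) euclidean (\<lambda>\<xi>. dual_map A B \<phi> \<xi> a)" if "a \<in> carrier A" for a
  proof (rule continuous_map_eq[OF continuous_map_evaluation[of "\<phi> a"]])
    show "\<phi> a \<in> carrier B"
      using that assms(2) by (auto simp: hom_def)
  qed (use that in \<open>simp add: topspace_dual_topology dual_map_apply\<close>)
  then have "continuous_map (dual_topology B) (product_topology (\<lambda>_. euclidean) (carrier A))
      (dual_map A B \<phi>)"
    using dual_map_closed[OF assms]
    by (auto simp: continuous_map_componentwise topspace_dual_topology carrier_dual_group)
  then show ?thesis
    unfolding dual_topology_def[of A] continuous_map_in_subtopology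
    using dual_map_closed[OF assms] by (auto simp: topspace_dual_topology)
qed

lemma space_borel_sets_of: "space (borel_sets_of X) = topspace X"
  by (simp add: borel_sets_of_def space_measure_of_conv)

lemma sets_borel_sets_of: "sets (borel_sets_of X) = sigma_sets (topspace X) {U. openin X U}"
  unfolding borel_sets_of_def by (rule sets_measure_of) (auto dest: openin_subset)

lemma open_in_borel_sets_of: "openin X U \<Longrightarrow> U \<in> sets (borel_sets_of X)"
  by (simp add: sets_borel_sets_of)

lemma continuous_map_borel_sets_of:
  assumes "continuous_map X Y f"
  shows "f \<in> measurable (borel_sets_of X) (borel_sets_of Y)"
  unfolding borel_sets_of_def[of Y]
proof (rule measurable_measure_of)
  show "f \<in> space (borel_sets_of X) \<rightarrow> topspace Y"
    using assms by (auto simp: space_borel_sets_of continuous_map_def)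
  fix U assume "U \<in> {U. openin Y U}"
  then show "f -` U \<inter> space (borel_sets_of X) \<in> sets (borel_sets_of X)"
    using openin_continuous_map_preimage[OF assms, of U]
    by (auto simp: space_borel_sets_of vimage_def Int_def conj_commute intro!: open_in_borel_sets_of)
qed (auto dest: openin_subset)

lemma continuous_map_borel_measurable:
  fixes f :: "'a \<Rightarrow> 'b::topological_space"
  assumes "continuous_map X euclidean f"
  shows "f \<in> borel_measurable (borel_sets_of X)"
proof (rule borel_measurableI)
  fix U :: "'b set" assume "open U"
  then show "f -` U \<inter> space (borel_sets_of X) \<in> sets (borel_sets_of X)"
    using openin_continuous_map_preimage[OF assms, of U]
    by (auto simp: space_borel_sets_of vimage_def Int_def conj_commute intro!: open_in_borel_sets_of)
qed

text \<open>Sets of characters given by a condition on their values on \<open>J\<close>. The set \<open>A\<close> is left arbitrary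
  instead of being a box, so that finite unions are again of this form.\<close>

definition cylinder :: "('b, 'm) monoid_scheme \<Rightarrow> 'b set \<Rightarrow> ('b \<Rightarrow> complex) set \<Rightarrow> ('b \<Rightarrow> complex) set"
  where "cylinder B J A = {\<xi> \<in> carrier (dual_group B). restrict \<xi> J \<in> A}"

lemma open_contains_box:
  assumes "openin (dual_topology B) U" "\<xi> \<in> U"
  shows "\<exists>W. (\<forall>b. open (W b)) \<and> finite {b \<in> carrier B. W b \<noteq> UNIV} \<and>
    \<xi> \<in> Pi\<^sub>E (carrier B) W \<and> carrier (dual_group B) \<inter> Pi\<^sub>E (carrier B) W \<subseteq> U"
proof -
  obtain T where T: "openin (product_topology (\<lambda>_. euclidean) (carrier B)) T"
    "U = T \<inter> carrier (dual_group B)"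
    using assms(1) by (auto simp: dual_topology_def openin_subtopology)
  then obtain W where W: "finite {b \<in> carrier B. W b \<noteq> UNIV}" "\<And>b. b \<in> carrier B \<Longrightarrow> open (W b)"
    "\<xi> \<in> Pi\<^sub>E (carrier B) W" "Pi\<^sub>E (carrier B) W \<subseteq> T"
    using assms(2) unfolding openin_product_topology_alt by auto
  \<comment> \<open>\<open>W\<close> says nothing outside the carrier; make it open there as well.\<close>
  define W' where "W' b = (if b \<in> carrier B then W b else UNIV)" for b
  have "Pi\<^sub>E (carrier B) W' = Pi\<^sub>E (carrier B) W"
    by (rule PiE_cong) (simp add: W'_def)
  moreover have "{b \<in> carrier B. W' b \<noteq> UNIV} = {b \<in> carrier B. W b \<noteq> UNIV}"
    by (auto simp: W'_def)
  ultimately show ?thesis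
    using W T(2) by (intro exI[of _ W'] conjI) (auto simp: W'_def)
qed

text \<open>Finitely many boxes cover a compact set, and each of them constrains finitely many values of a
  character, so the covering is a condition on the values on one finite set \<open>J\<close>.\<close>

lemma compact_open_cylinder:
  assumes "compactin (dual_topology B) C" "openin (dual_topology B) U" "C \<subseteq> U"
  obtains J A where "finite J" "J \<subseteq> carrier B" "A \<in> sets (Pi\<^sub>M J (\<lambda>_. borel))"
    "C \<subseteq> cylinder B J A" "cylinder B J A \<subseteq> U"
proof -
  let ?K = "carrier (dual_group B)"
  have "\<exists>W. (\<forall>b. open (W b)) \<and> finite {b \<in> carrier B. W b \<noteq> UNIV} \<and>
      \<xi> \<in> Pi\<^sub>E (carrier B) W \<and> ?K \<inter> Pi\<^sub>E (carrier B) W \<subseteq> U" if "\<xi> \<in> C" for \<xi>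
    by (rule open_contains_box[OF assms(2)]) (use that assms(3) in blast)
  then obtain W where "\<forall>\<xi>\<in>C. (\<forall>b. open (W \<xi> b)) \<and> finite {b \<in> carrier B. W \<xi> b \<noteq> UNIV} \<and>
      \<xi> \<in> Pi\<^sub>E (carrier B) (W \<xi>) \<and> ?K \<inter> Pi\<^sub>E (carrier B) (W \<xi>) \<subseteq> U"
    by (rule bchoice[THEN exE, OF ballI])
  then have W: "\<And>\<xi> b. \<xi> \<in> C \<Longrightarrow> open (W \<xi> b)"
    "\<And>\<xi>. \<xi> \<in> C \<Longrightarrow> finite {b \<in> carrier B. W \<xi> b \<noteq> UNIV}"
    "\<And>\<xi>. \<xi> \<in> C \<Longrightarrow> \<xi> \<in> Pi\<^sub>E (carrier B) (W \<xi>)"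
    "\<And>\<xi>. \<xi> \<in> C \<Longrightarrow> ?K \<inter> Pi\<^sub>E (carrier B) (W \<xi>) \<subseteq> U"
    by blast+
  have CK: "C \<subseteq> ?K"
    using assms(1) by (simp add: compactin_def topspace_dual_topology)
  have "openin (dual_topology B) (?K \<inter> Pi\<^sub>E (carrier B) (W \<xi>))" if "\<xi> \<in> C" for \<xi>
    unfolding dual_topology_def using W(1,2)[OF that]
    by (intro openin_subtopology_Int2) (auto simp: openin_PiE_gen)
  moreover have "C \<subseteq> \<Union> ((\<lambda>\<xi>. ?K \<inter> Pi\<^sub>E (carrier B) (W \<xi>)) ` C)"
    using CK W(3) by blast
  ultimately obtain \<F> where "finite \<F>" "\<F> \<subseteq> (\<lambda>\<xi>. ?K \<inter> Pi\<^sub>E (carrier B) (W \<xi>)) ` C" "C \<subseteq> \<Union>\<F>"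
    using compactinD[OF assms(1), of "(\<lambda>\<xi>. ?K \<inter> Pi\<^sub>E (carrier B) (W \<xi>)) ` C"] by auto
  moreover from this(1,2) obtain F where "F \<subseteq> C" "finite F"
    "\<F> = (\<lambda>\<xi>. ?K \<inter> Pi\<^sub>E (carrier B) (W \<xi>)) ` F"
    using finite_subset_image[of \<F>] by blast
  ultimately have F: "finite F" "F \<subseteq> C" "C \<subseteq> (\<Union>\<xi>\<in>F. ?K \<inter> Pi\<^sub>E (carrier B) (W \<xi>))"
    by simp_all
  define J where "J = (\<Union>\<xi>\<in>F. {b \<in> carrier B. W \<xi> b \<noteq> UNIV})"
  define A where "A = (\<Union>\<xi>\<in>F. Pi\<^sub>E J (W \<xi>))"
  have J: "finite J" "J \<subseteq> carrier B"
    using F W(2) by (auto simp: J_def)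
  have box: "restrict \<eta> J \<in> Pi\<^sub>E J (W \<xi>) \<longleftrightarrow> \<eta> \<in> Pi\<^sub>E (carrier B) (W \<xi>)"
    if "\<xi> \<in> F" "\<eta> \<in> ?K" for \<xi> \<eta>
  proof -
    have "W \<xi> b = UNIV" if "b \<in> carrier B" "b \<notin> J" for b
      using that \<open>\<xi> \<in> F\<close> by (auto simp: J_def)
    then show ?thesis
      using \<open>\<eta> \<in> ?K\<close> J(2) by (auto simp: PiE_iff carrier_dual_group)
  qed
  have "A \<in> sets (Pi\<^sub>M J (\<lambda>_. borel))"
    unfolding A_def using F(1,2) J(1) W(1)
    by (intro sets.finite_UN sets_PiM_I_finite) auto
  moreover have "C \<subseteq> cylinder B J A"
  proof
    fix \<eta> assume "\<eta> \<in> C"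
    then obtain \<xi> where "\<xi> \<in> F" "\<eta> \<in> ?K" "\<eta> \<in> Pi\<^sub>E (carrier B) (W \<xi>)"
      using F(3) by blast
    then show "\<eta> \<in> cylinder B J A"
      using box by (auto simp: cylinder_def A_def)
  qed
  moreover have "cylinder B J A \<subseteq> U"
  proof
    fix \<eta> assume "\<eta> \<in> cylinder B J A"
    then obtain \<xi> where "\<xi> \<in> F" "\<eta> \<in> ?K" "restrict \<eta> J \<in> Pi\<^sub>E J (W \<xi>)"
      by (auto simp: cylinder_def A_def)
    then show "\<eta> \<in> U"
      using box W(4) F(2) by blast
  qed
  ultimately show thesis
    using J that by blast
qed


section \<open>Haar measure of a dual group\<close>

text \<open>The argument for uniqueness of Haar measure: integrating the indicator of \<open>x \<otimes> y \<in> A\<close> in either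
  order gives the mass of \<open>A\<close> under either measure. Only the sets \<open>A\<close> for which this indicator is
  measurable for the product \<open>\<sigma>\<close>-algebra are covered; on the dual of a large group these
  need not be all Borel sets.\<close>

lemma invariant_measures_agree:
  assumes "comm_group G" "finite_measure M" "finite_measure N"
    and M: "space M = carrier G" "emeasure M (carrier G) = 1"
    and N: "space N = carrier G" "emeasure N (carrier G) = 1"
    and invM: "\<And>g. g \<in> carrier G \<Longrightarrow> emeasure M {x \<in> carrier G. g \<otimes>\<^bsub>G\<^esub> x \<in> A} = a"
    and invN: "\<And>g. g \<in> carrier G \<Longrightarrow> emeasure N {x \<in> carrier G. g \<otimes>\<^bsub>G\<^esub> x \<in> A} = b"
    and meas: "{(x, y) \<in> carrier G \<times> carrier G. x \<otimes>\<^bsub>G\<^esub> y \<in> A} \<in> sets (M \<Otimes>\<^sub>M N)"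
  shows "a = b"
proof -
  interpret G: comm_group G by fact
  interpret M: finite_measure M by fact
  interpret N: finite_measure N by fact
  interpret pair_sigma_finite M N ..
  let ?E = "{(x, y) \<in> carrier G \<times> carrier G. x \<otimes>\<^bsub>G\<^esub> y \<in> A}"
  have "emeasure (M \<Otimes>\<^sub>M N) ?E = (\<integral>\<^sup>+x. emeasure N (Pair x -` ?E) \<partial>M)"
    by (rule N.emeasure_pair_measure_alt[OF meas])
  also have "\<dots> = (\<integral>\<^sup>+x. b \<partial>M)"
  proof (rule nn_integral_cong)
    fix x assume "x \<in> space M"
    then have "Pair x -` ?E = {y \<in> carrier G. x \<otimes>\<^bsub>G\<^esub> y \<in> A}"
      by (auto simp: M)
    then show "emeasure N (Pair x -` ?E) = b"
      using invN \<open>x \<in> space M\<close> by (simp add: M)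
  qed
  finally have b: "emeasure (M \<Otimes>\<^sub>M N) ?E = b"
    by (simp add: M)
  have "emeasure (M \<Otimes>\<^sub>M N) ?E = (\<integral>\<^sup>+y. emeasure M ((\<lambda>x. (x, y)) -` ?E) \<partial>N)"
    by (rule emeasure_pair_measure_alt2[OF meas])
  also have "\<dots> = (\<integral>\<^sup>+y. a \<partial>N)"
  proof (rule nn_integral_cong)
    fix y assume "y \<in> space N"
    then have "(\<lambda>x. (x, y)) -` ?E = {x \<in> carrier G. y \<otimes>\<^bsub>G\<^esub> x \<in> A}"
      by (auto simp: N G.m_comm)
    then show "emeasure M ((\<lambda>x. (x, y)) -` ?E) = a"
      using invM \<open>y \<in> space N\<close> by (simp add: N)
  qed
  finally show ?thesis
    using b by (simp add: N)
qed

locale dual_haar = comm_group B for B :: "('b, 'm) monoid_scheme" (structure) +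
  fixes \<mu> :: "('b \<Rightarrow> complex) measure"
  assumes haar: "normalized_haar_measure (dual_group B) (dual_topology B) \<mu>"
begin

abbreviation K :: "('b \<Rightarrow> complex) set" where "K \<equiv> carrier (dual_group B)"

sublocale dual: comm_group "dual_group B"
  by (rule comm_group_dual)

lemma space_haar: "space \<mu> = K"
  using haar by (simp add: normalized_haar_measure_def topspace_dual_topology)

lemma sets_haar: "sets \<mu> = sets (borel_sets_of (dual_topology B))"
  using haar by (simp add: normalized_haar_measure_def)

lemma emeasure_haar_space: "emeasure \<mu> K = 1"
  using haar unfolding normalized_haar_measure_def space_haar by (elim conjE)

sublocale finite_measure \<mu>
  by (rule finite_measureI) (simp add: space_haar emeasure_haar_space)

lemma evaluation_measurable: "b \<in> carrier B \<Longrightarrow> (\<lambda>\<xi>. \<xi> b) \<in> borel_measurable \<mu>"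
  using continuous_map_borel_measurable[OF continuous_map_evaluation, of b B]
  by (simp add: measurable_cong_sets[OF sets_haar refl])

lemma restrict_measurable: "J \<subseteq> carrier B \<Longrightarrow> (\<lambda>\<xi>. restrict \<xi> J) \<in> measurable \<mu> (Pi\<^sub>M J (\<lambda>_. borel))"
  by (intro measurable_restrict evaluation_measurable) auto

lemma cylinder_measurable:
  assumes "J \<subseteq> carrier B" "A \<in> sets (Pi\<^sub>M J (\<lambda>_. borel))"
  shows "cylinder B J A \<in> sets \<mu>"
proof -
  have "cylinder B J A = (\<lambda>\<xi>. restrict \<xi> J) -` A \<inter> space \<mu>"
    by (auto simp: cylinder_def space_haar)
  then show ?thesis
    using measurable_sets[OF restrict_measurable[OF assms(1)] assms(2)] by simp
qed

lemma open_measurable: "openin (dual_topology B) U \<Longrightarrow> U \<in> sets \<mu>"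
  by (simp add: sets_haar open_in_borel_sets_of)

lemma dual_aut_measurable: "\<alpha> \<in> auto B \<Longrightarrow> dual_aut B \<alpha> \<in> measurable \<mu> \<mu>"
  using continuous_map_borel_sets_of[OF continuous_map_dual_map[of B \<alpha> B]]
  by (simp add: measurable_cong_sets[OF sets_haar sets_haar] dual_aut_def auto_hom group_axioms)

text \<open>The invariance of the definition speaks of images of Borel sets; preimages are images under the
  inverse translation.\<close>

lemma translation_invariant:
  assumes g: "g \<in> K" and A: "A \<in> sets \<mu>"
  shows "emeasure \<mu> {\<xi> \<in> K. g \<otimes>\<^bsub>dual_group B\<^esub> \<xi> \<in> A} = emeasure \<mu> A"
proof -
  have AK: "A \<subseteq> K"
    using sets.sets_into_space[OF A] by (simp add: space_haar)
  let ?i = "inv\<^bsub>dual_group B\<^esub> g"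
  have "{\<xi> \<in> K. g \<otimes>\<^bsub>dual_group B\<^esub> \<xi> \<in> A} = (\<lambda>\<xi>. ?i \<otimes>\<^bsub>dual_group B\<^esub> \<xi>) ` A"
  proof (intro equalityI subsetI)
    fix \<xi> assume "\<xi> \<in> {\<xi> \<in> K. g \<otimes>\<^bsub>dual_group B\<^esub> \<xi> \<in> A}"
    then have "\<xi> = ?i \<otimes>\<^bsub>dual_group B\<^esub> (g \<otimes>\<^bsub>dual_group B\<^esub> \<xi>)" "g \<otimes>\<^bsub>dual_group B\<^esub> \<xi> \<in> A"
      using g by (simp_all add: dual.m_assoc[symmetric])
    then show "\<xi> \<in> (\<lambda>\<xi>. ?i \<otimes>\<^bsub>dual_group B\<^esub> \<xi>) ` A"
      by (rule image_eqI)
  next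
    fix \<xi> assume "\<xi> \<in> (\<lambda>\<xi>. ?i \<otimes>\<^bsub>dual_group B\<^esub> \<xi>) ` A"
    then obtain \<psi> where \<psi>: "\<psi> \<in> A" "\<xi> = ?i \<otimes>\<^bsub>dual_group B\<^esub> \<psi>"
      by blast
    then have "\<psi> \<in> K"
      using AK by blast
    then have "g \<otimes>\<^bsub>dual_group B\<^esub> \<xi> = \<psi>"
      using g \<psi>(2) by (simp add: dual.m_assoc[symmetric])
    then show "\<xi> \<in> {\<xi> \<in> K. g \<otimes>\<^bsub>dual_group B\<^esub> \<xi> \<in> A}"
      using g \<psi> \<open>\<psi> \<in> K\<close> by simp
  qed
  then show ?thesis
    using haar g A by (simp add: normalized_haar_measure_def)
qed

text \<open>Inner regularity by compact sets improves to inner regularity by cylinders, since a cylinder fits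
  between a compact set and an open set around it.\<close>

lemma open_inner_cylinder:
  assumes U: "openin (dual_topology B) U" and "e > 0"
  obtains J A where "finite J" "J \<subseteq> carrier B" "A \<in> sets (Pi\<^sub>M J (\<lambda>_. borel))"
    "cylinder B J A \<subseteq> U" "measure \<mu> U < measure \<mu> (cylinder B J A) + e"
proof (cases "measure \<mu> U < e")
  case True
  then show thesis
    by (intro that[of "{}" "{}"]) (auto simp: cylinder_def)
next
  case False
  have "ennreal (measure \<mu> U - e) < emeasure \<mu> U"
    using False \<open>e > 0\<close> by (simp add: emeasure_eq_measure ennreal_less_iff)
  also have "emeasure \<mu> U
      = (SUP C\<in>{C. compactin (dual_topology B) C \<and> closedin (dual_topology B) C \<and> C \<subseteq> U}. emeasure \<mu> C)"
    using haar U by (simp add: normalized_haar_measure_def)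
  finally obtain C where C: "compactin (dual_topology B) C" "C \<subseteq> U"
    and less: "ennreal (measure \<mu> U - e) < emeasure \<mu> C"
    by (auto simp: less_SUP_iff)
  obtain J A where J: "finite J" "J \<subseteq> carrier B" "A \<in> sets (Pi\<^sub>M J (\<lambda>_. borel))"
    and CV: "C \<subseteq> cylinder B J A" "cylinder B J A \<subseteq> U"
    by (rule compact_open_cylinder[OF C(1) U C(2)])
  have "ennreal (measure \<mu> U - e) < emeasure \<mu> (cylinder B J A)"
    using less emeasure_mono[OF CV(1) cylinder_measurable[OF J(2,3)]] by (rule less_le_trans)
  then have "measure \<mu> U < measure \<mu> (cylinder B J A) + e"
    using False by (simp add: emeasure_eq_measure ennreal_less_iff)
  then show thesis
    using that J CV(2) by blast
qed

lemma Borel_outer_open: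
  assumes A: "A \<in> sets \<mu>" and "e > 0"
  obtains U where "openin (dual_topology B) U" "A \<subseteq> U" "measure \<mu> U < measure \<mu> A + e"
proof -
  have "(INF U\<in>{U. openin (dual_topology B) U \<and> A \<subseteq> U}. emeasure \<mu> U) = emeasure \<mu> A"
    using haar A by (simp add: normalized_haar_measure_def)
  also have "\<dots> < ennreal (measure \<mu> A + e)"
    using \<open>e > 0\<close> by (simp add: emeasure_eq_measure ennreal_less_iff)
  finally obtain U where "openin (dual_topology B) U" "A \<subseteq> U"
    "emeasure \<mu> U < ennreal (measure \<mu> A + e)"
    by (auto simp: INF_less_iff)
  then show thesis
    using that by (simp add: emeasure_eq_measure ennreal_less_iff)
qed

text \<open>The image of \<open>\<mu>\<close> under the dual automorphism is again translation invariant, because that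
  automorphism is a surjective homomorphism. On cylinders the two invariant measures must agree:
  whether \<open>x \<otimes> y\<close> lies in a cylinder depends measurably on finitely many values of \<open>x\<close> and \<open>y\<close>.\<close>

lemma dual_aut_cylinder_invariant:
  assumes \<alpha>: "\<alpha> \<in> auto B" and J: "J \<subseteq> carrier B" and A: "A \<in> sets (Pi\<^sub>M J (\<lambda>_. borel))"
  shows "emeasure (distr \<mu> \<mu> (dual_aut B \<alpha>)) (cylinder B J A) = emeasure \<mu> (cylinder B J A)"
proof -
  let ?T = "dual_aut B \<alpha>" and ?V = "cylinder B J A"
  let ?N = "distr \<mu> \<mu> ?T"
  have T: "?T \<in> measurable \<mu> \<mu>"
    using \<alpha> by (rule dual_aut_measurable)
  have V: "?V \<in> sets \<mu>"
    using J A by (rule cylinder_measurable)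
  have aut: "?T \<in> auto (dual_group B)"
    using \<alpha> by (rule dual_aut_in_auto)
  have mult_cylinder: "x \<otimes>\<^bsub>dual_group B\<^esub> y \<in> ?V \<longleftrightarrow> (\<lambda>b\<in>J. x b * y b) \<in> A"
    if "x \<in> K" "y \<in> K" for x y
  proof -
    have "restrict (x \<otimes>\<^bsub>dual_group B\<^esub> y) J = (\<lambda>b\<in>J. x b * y b)"
      using J by (simp add: mult_dual_group Int_absorb1)
    then show ?thesis
      using dual.m_closed[OF that] by (simp add: cylinder_def)
  qed
  have "emeasure \<mu> ?V = emeasure \<mu> (?T -` ?V \<inter> space \<mu>)"
  proof (rule invariant_measures_agree[where G = "dual_group B" and M = \<mu> and N = ?N and A = ?V])
    show "comm_group (dual_group B)" "finite_measure \<mu>"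
      by unfold_locales
    show "finite_measure ?N"
      using T by (rule finite_measure_distr)
    show "space \<mu> = K" "emeasure \<mu> K = 1" "space ?N = K"
      by (simp_all add: space_haar emeasure_haar_space)
    have "?T -` K \<inter> space \<mu> = K"
      using measurable_space[OF T] by (auto simp: space_haar)
    then show "emeasure ?N K = 1"
      using emeasure_distr[OF T, of K] sets.top[of \<mu>] by (simp add: space_haar emeasure_haar_space)
    fix g assume g: "g \<in> K"
    show "emeasure \<mu> {\<xi> \<in> K. g \<otimes>\<^bsub>dual_group B\<^esub> \<xi> \<in> ?V} = emeasure \<mu> ?V"
      using g V by (rule translation_invariant)
    have "g \<in> ?T ` K"
      using aut g by (simp add: auto_def Bij_def bij_betw_def)
    then obtain h where h: "h \<in> K" "?T h = g"
      by blast
    have mult: "?T (h \<otimes>\<^bsub>dual_group B\<^esub> \<xi>) = g \<otimes>\<^bsub>dual_group B\<^esub> ?T \<xi>" if "\<xi> \<in> K" for \<xi>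
      using aut h that by (auto simp: auto_def hom_def)
    have meas: "{\<xi> \<in> K. g \<otimes>\<^bsub>dual_group B\<^esub> \<xi> \<in> ?V} \<in> sets \<mu>"
    proof -
      have "(\<lambda>\<xi>. \<lambda>b\<in>J. g b * \<xi> b) \<in> measurable \<mu> (Pi\<^sub>M J (\<lambda>_. borel))"
        using J by (intro measurable_restrict borel_measurable_times evaluation_measurable) auto
      moreover have "{\<xi> \<in> K. g \<otimes>\<^bsub>dual_group B\<^esub> \<xi> \<in> ?V} = (\<lambda>\<xi>. \<lambda>b\<in>J. g b * \<xi> b) -` A \<inter> space \<mu>"
        using g by (auto simp: space_haar mult_cylinder)
      ultimately show ?thesis
        using measurable_sets[OF _ A] by metis
    qed
    have "?T -` {\<xi> \<in> K. g \<otimes>\<^bsub>dual_group B\<^esub> \<xi> \<in> ?V} \<inter> space \<mu>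
        = {\<xi> \<in> K. g \<otimes>\<^bsub>dual_group B\<^esub> ?T \<xi> \<in> ?V}"
      using dual_aut_closed[OF \<alpha>] by (auto simp: space_haar)
    also have "\<dots> = {\<xi> \<in> K. h \<otimes>\<^bsub>dual_group B\<^esub> \<xi> \<in> ?T -` ?V \<inter> space \<mu>}"
      using h(1) by (simp add: space_haar mult cong: conj_cong)
    finally have preimage: "?T -` {\<xi> \<in> K. g \<otimes>\<^bsub>dual_group B\<^esub> \<xi> \<in> ?V} \<inter> space \<mu>
        = {\<xi> \<in> K. h \<otimes>\<^bsub>dual_group B\<^esub> \<xi> \<in> ?T -` ?V \<inter> space \<mu>}" .
    have "emeasure ?N {\<xi> \<in> K. g \<otimes>\<^bsub>dual_group B\<^esub> \<xi> \<in> ?V}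
        = emeasure \<mu> {\<xi> \<in> K. h \<otimes>\<^bsub>dual_group B\<^esub> \<xi> \<in> ?T -` ?V \<inter> space \<mu>}"
      by (simp only: emeasure_distr[OF T meas] preimage)
    also have "\<dots> = emeasure \<mu> (?T -` ?V \<inter> space \<mu>)"
      using h(1) measurable_sets[OF T V] by (rule translation_invariant)
    finally show "emeasure ?N {\<xi> \<in> K. g \<otimes>\<^bsub>dual_group B\<^esub> \<xi> \<in> ?V} = emeasure \<mu> (?T -` ?V \<inter> space \<mu>)" .
  next
    let ?m = "\<lambda>p. \<lambda>b\<in>J. fst p b * snd p b"
    have m: "?m \<in> measurable (\<mu> \<Otimes>\<^sub>M ?N) (Pi\<^sub>M J (\<lambda>_. borel))"
    proof (intro measurable_restrict borel_measurable_times)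
      fix b assume "b \<in> J"
      then have "(\<lambda>\<xi>. \<xi> b) \<in> borel_measurable \<mu>" "(\<lambda>\<xi>. \<xi> b) \<in> borel_measurable ?N"
        using evaluation_measurable J by auto
      then show "(\<lambda>p. fst p b) \<in> borel_measurable (\<mu> \<Otimes>\<^sub>M ?N)" "(\<lambda>p. snd p b) \<in> borel_measurable (\<mu> \<Otimes>\<^sub>M ?N)"
        by (auto intro: measurable_compose[OF measurable_fst] measurable_compose[OF measurable_snd])
    qed
    have E: "{(x, y) \<in> K \<times> K. x \<otimes>\<^bsub>dual_group B\<^esub> y \<in> ?V} = ?m -` A \<inter> space (\<mu> \<Otimes>\<^sub>M ?N)"
      by (auto simp: space_haar space_pair_measure mult_cylinder)
    show "{(x, y) \<in> K \<times> K. x \<otimes>\<^bsub>dual_group B\<^esub> y \<in> ?V} \<in> sets (\<mu> \<Otimes>\<^sub>M ?N)"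
      unfolding E by (rule measurable_sets[OF m A])
  qed
  then show ?thesis
    by (simp add: emeasure_distr[OF T V])
qed

lemma dual_aut_open_le:
  assumes \<alpha>: "\<alpha> \<in> auto B" and U: "openin (dual_topology B) U"
  shows "measure \<mu> U \<le> measure (distr \<mu> \<mu> (dual_aut B \<alpha>)) U"
proof (rule field_le_epsilon)
  fix e :: real assume "e > 0"
  interpret N: finite_measure "distr \<mu> \<mu> (dual_aut B \<alpha>)"
    using dual_aut_measurable[OF \<alpha>] by (rule finite_measure_distr)
  obtain J A where J: "J \<subseteq> carrier B" "A \<in> sets (Pi\<^sub>M J (\<lambda>_. borel))"
    and V: "cylinder B J A \<subseteq> U" "measure \<mu> U < measure \<mu> (cylinder B J A) + e"
    by (rule open_inner_cylinder[OF U \<open>e > 0\<close>])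
  have "measure \<mu> (cylinder B J A) = measure (distr \<mu> \<mu> (dual_aut B \<alpha>)) (cylinder B J A)"
    by (simp add: measure_def dual_aut_cylinder_invariant[OF \<alpha> J])
  also have "\<dots> \<le> measure (distr \<mu> \<mu> (dual_aut B \<alpha>)) U"
    using V(1) open_measurable[OF U] by (intro N.finite_measure_mono) auto
  finally show "measure \<mu> U \<le> measure (distr \<mu> \<mu> (dual_aut B \<alpha>)) U + e"
    using V(2) by simp
qed

text \<open>Regularity passes from cylinders to open sets only with an inequality. Applying it to the
  automorphism and to its inverse gives equality, and the open sets generate the Borel sets.\<close>

lemma dual_aut_preserves_haar:
  assumes \<alpha>: "\<alpha> \<in> auto B"
  shows "distr \<mu> \<mu> (dual_aut B \<alpha>) = \<mu>"
proof -
  let ?T = "dual_aut B \<alpha>"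
  define \<beta> where "\<beta> = inv\<^bsub>AutoGroup B\<^esub> \<alpha>"
  have \<beta>: "\<beta> \<in> auto B" "\<alpha> \<otimes>\<^bsub>AutoGroup B\<^esub> \<beta> = \<one>\<^bsub>AutoGroup B\<^esub>"
    using group.inv_closed[OF AutoGroup, of \<alpha>] group.r_inv[OF AutoGroup, of \<alpha>] \<alpha>
    by (simp_all add: \<beta>_def carrier_AutoGroup)
  have T: "?T \<in> measurable \<mu> \<mu>" and S: "dual_aut B \<beta> \<in> measurable \<mu> \<mu>"
    using \<alpha> \<beta>(1) by (auto intro: dual_aut_measurable)
  have TS: "?T (dual_aut B \<beta> \<xi>) = \<xi>" if "\<xi> \<in> K" for \<xi>
  proof -
    have "dual_aut B \<beta> (?T \<xi>) = \<xi>" if "\<xi> \<in> K" for \<xi>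
    proof -
      have "dual_aut B \<beta> (?T \<xi>) = dual_aut B \<one>\<^bsub>AutoGroup B\<^esub> \<xi>"
        by (simp only: dual_aut_dual_aut[OF \<beta>(1) \<alpha> that] \<beta>(2))
      also have "\<dots> = \<xi>"
        unfolding dual_aut_def using that by (rule dual_map_identity) (simp add: one_AutoGroup)
      finally show ?thesis .
    qed
    moreover have "bij_betw (dual_aut B \<beta>) K K"
      using dual_aut_in_auto[OF \<beta>(1)] by (simp add: auto_def Bij_def)
    ultimately show ?thesis
      using that \<alpha> \<beta>(1) dual_aut_closed
      by (auto simp: bij_betw_def inj_on_def)
  qed
  have open_eq: "emeasure (distr \<mu> \<mu> ?T) U = emeasure \<mu> U" if U: "openin (dual_topology B) U" for U
  proof -
    interpret N: finite_measure "distr \<mu> \<mu> ?T"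
      using T by (rule finite_measure_distr)
    have UK: "U \<subseteq> K"
      using openin_subset[OF U] by (simp add: topspace_dual_topology)
    have T_cont: "continuous_map (dual_topology B) (dual_topology B) ?T"
      unfolding dual_aut_def by (intro continuous_map_dual_map group_axioms auto_hom \<alpha>)
    have U': "openin (dual_topology B) {\<xi> \<in> K. ?T \<xi> \<in> U}"
      using openin_continuous_map_preimage[OF T_cont U] by (simp add: topspace_dual_topology)
    have "measure (distr \<mu> \<mu> ?T) U = measure \<mu> {\<xi> \<in> K. ?T \<xi> \<in> U}"
      using measure_distr[OF T open_measurable[OF U]]
      by (simp add: space_haar vimage_def Int_def conj_commute)
    also have "\<dots> \<le> measure (distr \<mu> \<mu> (dual_aut B \<beta>)) {\<xi> \<in> K. ?T \<xi> \<in> U}"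
      by (rule dual_aut_open_le[OF \<beta>(1) U'])
    also have "\<dots> = measure \<mu> (dual_aut B \<beta> -` {\<xi> \<in> K. ?T \<xi> \<in> U} \<inter> space \<mu>)"
      by (rule measure_distr[OF S open_measurable[OF U']])
    also have "dual_aut B \<beta> -` {\<xi> \<in> K. ?T \<xi> \<in> U} \<inter> space \<mu> = U"
      using UK measurable_space[OF S] TS by (auto simp: space_haar)
    finally have "measure (distr \<mu> \<mu> ?T) U = measure \<mu> U"
      using dual_aut_open_le[OF \<alpha> U] by simp
    then show ?thesis
      by (simp add: emeasure_eq_measure N.emeasure_eq_measure)
  qed
  show ?thesis
  proof (rule measure_eqI_generator_eq)
    show "Int_stable {U. openin (dual_topology B) U}"
      by (auto simp: Int_stable_def)
    show "{U. openin (dual_topology B) U} \<subseteq> Pow K"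
      using openin_subset[of "dual_topology B"] by (auto simp: topspace_dual_topology)
    show "sets (distr \<mu> \<mu> ?T) = sigma_sets K {U. openin (dual_topology B) U}"
      "sets \<mu> = sigma_sets K {U. openin (dual_topology B) U}"
      by (simp_all add: sets_haar sets_borel_sets_of topspace_dual_topology)
    show "range (\<lambda>_::nat. K) \<subseteq> {U. openin (dual_topology B) U}"
      using openin_topspace[of "dual_topology B"] by (auto simp: topspace_dual_topology)
    show "emeasure (distr \<mu> \<mu> ?T) K \<noteq> \<infinity>"
      using open_eq[of K] openin_topspace[of "dual_topology B"]
      by (simp add: topspace_dual_topology emeasure_haar_space)
  qed (auto simp: open_eq)
qed

end


section \<open>The dilation\<close>

text \<open>\<open>BH\<close> is the group \<open>H\<close>, with dual \<open>KH\<close>; \<open>\<alpha>H\<close> is the endomorphism of the dual of \<open>H\<close>, not of \<open>H\<close>.\<close>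

locale dilation = dual_haar B \<mu> for B :: "('b, 'm) monoid_scheme" (structure) and \<mu> +
  fixes \<alpha> :: "'b \<Rightarrow> 'b" and H :: "'b set"
  assumes \<alpha>: "\<alpha> \<in> auto B"
    and H: "subgroup H B"
    and H_invariant: "\<alpha> ` H \<subseteq> H"
    and H_exhausts: "(\<Union>n::nat. (\<alpha> [^]\<^bsub>AutoGroup B\<^esub> (- int n)) ` H) = carrier B"
begin

abbreviation BH :: "('b, 'm) monoid_scheme" where "BH \<equiv> subgroup_of B H"
abbreviation KH :: "('b \<Rightarrow> complex) set" where "KH \<equiv> carrier (dual_group BH)"
abbreviation \<mu>H :: "('b \<Rightarrow> complex) measure" where "\<mu>H \<equiv> mu_sub B H \<mu>"
abbreviation \<theta> :: "('b \<Rightarrow> complex) \<Rightarrow> 'b \<Rightarrow> complex" where "\<theta> \<equiv> theta0 B H"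
abbreviation \<alpha>H :: "('b \<Rightarrow> complex) \<Rightarrow> 'b \<Rightarrow> complex" where "\<alpha>H \<equiv> dual_endo_sub B H \<alpha>"
abbreviation pow :: "int \<Rightarrow> 'b \<Rightarrow> 'b" where "pow j \<equiv> \<alpha> [^]\<^bsub>AutoGroup B\<^esub> j"

sublocale BH: group BH
  by (rule subgroup.subgroup_is_group[OF H]) (rule group_axioms)

lemma H_subset: "h \<in> H \<Longrightarrow> h \<in> carrier B"
  using subgroup.subset[OF H] by blast

lemma inclusion_hom: "(\<lambda>h. h) \<in> hom BH B"
  by (auto simp: hom_def H_subset)

lemma restrict_hom: "restrict \<alpha> H \<in> hom BH BH"
  using auto_hom[OF \<alpha>] H_invariant H_subset subgroup.m_closed[OF H] by (auto simp: hom_def Pi_iff)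

lemma theta_closed: "\<xi> \<in> K \<Longrightarrow> \<theta> \<xi> \<in> KH"
  unfolding theta0_def by (intro dual_map_closed BH.group_axioms inclusion_hom)

lemma theta_apply: "\<lbrakk>\<xi> \<in> K; h \<in> H\<rbrakk> \<Longrightarrow> \<theta> \<xi> h = \<xi> h"
  by (simp add: theta0_def dual_map_apply)

lemma endo_closed: "z \<in> KH \<Longrightarrow> \<alpha>H z \<in> KH"
  unfolding dual_endo_sub_def by (intro dual_map_closed BH.group_axioms restrict_hom)

lemma endo_apply: "\<lbrakk>z \<in> KH; h \<in> H\<rbrakk> \<Longrightarrow> \<alpha>H z h = z (\<alpha> h)"
  by (simp add: dual_endo_sub_def dual_map_apply)

lemma dual_aut_apply: "\<lbrakk>\<beta> \<in> auto B; \<xi> \<in> K; b \<in> carrier B\<rbrakk> \<Longrightarrow> dual_aut B \<beta> \<xi> b = \<xi> (\<beta> b)"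
  by (simp add: dual_aut_def dual_map_apply)

lemma theta_dual_aut:
  assumes "\<xi> \<in> K"
  shows "\<theta> (dual_aut B \<alpha> \<xi>) = \<alpha>H (\<theta> \<xi>)"
proof (rule character_eqI[of _ BH])
  fix h assume "h \<in> carrier BH"
  then have "h \<in> H" "\<alpha> h \<in> H"
    using H_invariant by auto
  then show "\<theta> (dual_aut B \<alpha> \<xi>) h = \<alpha>H (\<theta> \<xi>) h"
    using assms by (simp add: theta_apply endo_apply theta_closed dual_aut_closed[OF \<alpha>]
        dual_aut_apply[OF \<alpha>] H_subset)
qed (use assms in \<open>auto intro: theta_closed endo_closed dual_aut_closed[OF \<alpha>]\<close>)

lemma sets_muH: "sets \<mu>H = sets (borel_sets_of (dual_topology BH))"
  by (simp add: mu_sub_def)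

lemma space_muH: "space \<mu>H = KH"
  by (simp add: mu_sub_def space_borel_sets_of topspace_dual_topology)

lemma theta_measurable_borel: "\<theta> \<in> measurable \<mu> (borel_sets_of (dual_topology BH))"
  using continuous_map_borel_sets_of[OF continuous_map_dual_map[OF BH.group_axioms inclusion_hom]]
  by (simp add: theta0_def measurable_cong_sets[OF sets_haar refl])

lemma theta_measurable: "\<theta> \<in> measurable \<mu> \<mu>H"
  using theta_measurable_borel by (simp add: measurable_cong_sets[OF refl sets_muH])

lemma distr_theta: "distr \<mu> \<mu>H \<theta> = \<mu>H"
  unfolding mu_sub_def by (rule distr_cong) (auto simp: mu_sub_def)

lemma finite_measure_muH: "finite_measure \<mu>H"
  using finite_measure_distr[OF theta_measurable] by (simp only: distr_theta)

lemma endo_measurable: "\<alpha>H \<in> measurable \<mu>H \<mu>H"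
  using continuous_map_borel_sets_of[OF continuous_map_dual_map[OF BH.group_axioms restrict_hom]]
  by (simp add: dual_endo_sub_def measurable_cong_sets[OF sets_muH sets_muH])

text \<open>Invariance descends from \<open>\<mu>\<close>, because \<open>\<mu>H\<close> is its image under \<open>\<theta>\<close> and \<open>\<theta>\<close> intertwines the dual
  automorphism of \<open>B\<close> with the dual endomorphism of \<open>H\<close>.\<close>

lemma endo_preserves_muH: "distr \<mu>H \<mu>H \<alpha>H = \<mu>H"
proof -
  have "distr \<mu>H \<mu>H \<alpha>H = distr (distr \<mu> \<mu>H \<theta>) \<mu>H \<alpha>H"
    by (simp only: distr_theta)
  also have "\<dots> = distr \<mu> \<mu>H (\<alpha>H \<circ> \<theta>)"
    by (rule distr_distr[OF endo_measurable theta_measurable])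
  also have "\<dots> = distr \<mu> \<mu>H (\<theta> \<circ> dual_aut B \<alpha>)"
    by (rule distr_cong) (auto simp: space_haar theta_dual_aut)
  also have "\<dots> = distr (distr \<mu> \<mu> (dual_aut B \<alpha>)) \<mu>H \<theta>"
    by (rule distr_distr[symmetric, OF theta_measurable dual_aut_measurable[OF \<alpha>]])
  also have "\<dots> = \<mu>H"
    by (simp only: dual_aut_preserves_haar[OF \<alpha>] distr_theta)
  finally show ?thesis .
qed

lemma evaluation_measurable_muH: "h \<in> H \<Longrightarrow> (\<lambda>z. z h) \<in> borel_measurable \<mu>H"
  using continuous_map_borel_measurable[OF continuous_map_evaluation, of h BH]
  by (simp add: measurable_cong_sets[OF sets_muH refl])

text \<open>The operators \<open>W\<close>, \<open>u\<close>, \<open>t\<^sub>h\<close> and \<open>U(j,b)\<close> are all unimodular weighted compositions, so each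
  identity between them comes down to evaluating characters.\<close>

lemma unimodular_W: "unimodular_composition \<mu>H \<mu> (\<lambda>_. 1) \<theta>"
  by unfold_locales (auto simp: theta_measurable distr_theta)

lemma unimodular_u: "unimodular_composition \<mu>H \<mu>H (\<lambda>_. 1) \<alpha>H"
  by unfold_locales (auto simp: endo_measurable endo_preserves_muH)

lemma unimodular_t: "h \<in> H \<Longrightarrow> unimodular_composition \<mu>H \<mu>H (\<lambda>z. z h) (\<lambda>z. z)"
  by unfold_locales (auto simp: evaluation_measurable_muH space_muH character_norm distr_id2)

lemma unimodular_U:
  "b \<in> carrier B \<Longrightarrow> unimodular_composition \<mu> \<mu> (\<lambda>\<xi>. \<xi> b) (dual_aut B (pow j))"
  by unfold_locales
    (auto simp: evaluation_measurable dual_aut_measurable dual_aut_preserves_haar auto_pow[OF \<alpha>]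
      space_haar character_norm)

lemma op_W_eq: "op_W B H \<mu> = l2_lift \<mu>H \<mu> (weighted_composition (\<lambda>_. 1) \<theta>)"
  by (simp add: op_W_def weighted_composition_def[abs_def])

lemma op_u_eq: "op_u B H \<alpha> \<mu> = l2_lift \<mu>H \<mu>H (weighted_composition (\<lambda>_. 1) \<alpha>H)"
  by (simp add: op_u_def weighted_composition_def[abs_def])

lemma op_t_eq: "op_t B H \<mu> h = l2_lift \<mu>H \<mu>H (weighted_composition (\<lambda>z. z h) (\<lambda>z. z))"
  by (simp add: op_t_def weighted_composition_def[abs_def])

lemma rep_U_eq:
  "rep_U B \<alpha> \<mu> (j, b) = l2_lift \<mu> \<mu> (weighted_composition (\<lambda>\<xi>. \<xi> b) (dual_aut B (pow j)))"
  by (simp add: rep_U_def weighted_composition_def[abs_def] dual_aut_int_pow[OF \<alpha>])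

lemma pow_closed: "b \<in> carrier B \<Longrightarrow> pow j b \<in> carrier B"
  using auto_closed auto_pow[OF \<alpha>] by blast

lemma pow_pow: "b \<in> carrier B \<Longrightarrow> pow i (pow j b) = pow (i + j) b"
  using auto_pow_add[OF \<alpha>] by simp

lemma dual_pow_closed: "\<xi> \<in> K \<Longrightarrow> dual_aut B (pow j) \<xi> \<in> K"
  by (intro dual_aut_closed auto_pow \<alpha>)

lemma dual_pow_apply: "\<lbrakk>\<xi> \<in> K; b \<in> carrier B\<rbrakk> \<Longrightarrow> dual_aut B (pow j) \<xi> b = \<xi> (pow j b)"
  by (intro dual_aut_apply auto_pow \<alpha>)

lemma dual_pow_dual_pow:
  assumes "\<xi> \<in> K"
  shows "dual_aut B (pow i) (dual_aut B (pow j) \<xi>) = dual_aut B (pow (i + j)) \<xi>"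
  by (rule character_eqI[of _ B])
     (simp_all add: assms dual_pow_closed dual_pow_apply pow_closed pow_pow add.commute)

lemma dual_pow_zero: "\<xi> \<in> K \<Longrightarrow> dual_aut B (pow 0) \<xi> = \<xi>"
  by (rule character_eqI[of _ B]) (simp_all only: dual_pow_closed dual_pow_apply auto_pow_zero)

lemma unitary_t:
  assumes "h \<in> H"
  shows "l2_unitary \<mu>H (op_t B H \<mu> h)"
proof -
  have inv: "inv h \<in> H"
    using subgroup.m_inv_closed[OF H assms] .
  have "z h * z (inv h) = 1" if "z \<in> KH" for z
    using character_mult[OF that, of h "inv h"] BH.character_one[OF that] assms inv H_subset by simp
  then show ?thesis
    unfolding op_t_eq
    by (intro weighted_composition_unitary[OF unimodular_t[OF assms] unimodular_t[OF inv]])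
       (simp_all add: space_muH mult.commute)
qed

text \<open>The inverse of \<open>(j, b)\<close> in the semidirect product is \<open>(-j, c)\<close> with \<open>\<alpha>\<^sup>j(c) = b\<^sup>-\<^sup>1\<close>.\<close>

lemma unitary_U:
  assumes b: "b \<in> carrier B"
  shows "l2_unitary \<mu> (rep_U B \<alpha> \<mu> (j, b))"
proof -
  define c where "c = pow (- j) (inv b)"
  have c: "c \<in> carrier B"
    using b by (simp add: c_def pow_closed)
  have "pow j c = inv b"
    using b by (simp add: c_def pow_pow one_AutoGroup)
  have bc: "\<xi> b * \<xi> (pow j c) = 1" if "\<xi> \<in> K" for \<xi>
    using character_mult[OF that, of b "inv b"] character_one[OF that] b \<open>pow j c = inv b\<close> by simp
  have cb: "\<xi> c * \<xi> (pow (- j) b) = 1" if "\<xi> \<in> K" for \<xi>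
  proof -
    have "dual_aut B (pow (- j)) \<xi> b * dual_aut B (pow (- j)) \<xi> (pow j c) = 1"
      using that by (intro bc dual_pow_closed)
    then show ?thesis
      using that b c by (simp add: dual_pow_apply pow_closed pow_pow one_AutoGroup mult.commute)
  qed
  show ?thesis
    unfolding rep_U_eq
    by (intro weighted_composition_unitary[OF unimodular_U[OF b] unimodular_U[OF c, of "- j"]])
       (simp_all add: space_haar b c bc cb dual_pow_apply dual_pow_dual_pow dual_pow_zero[simplified])
qed

lemma representation_U: "unitary_representation (semidirect_int B \<alpha>) \<mu> (rep_U B \<alpha> \<mu>)"
  unfolding unitary_representation_def
proof (intro conjI ballI)
  fix g assume "g \<in> carrier (semidirect_int B \<alpha>)"
  then show "l2_unitary \<mu> (rep_U B \<alpha> \<mu> g)"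
    by (cases g) (simp add: semidirect_int_def unitary_U)
next
  fix F assume F: "F \<in> L2 \<mu>"
  have "rep_U B \<alpha> \<mu> (0, \<one>) F = F"
    unfolding rep_U_eq
    by (rule weighted_composition_identity[OF unimodular_U F])
       (simp_all only: one_closed space_haar character_one dual_pow_zero)
  then show "rep_U B \<alpha> \<mu> \<one>\<^bsub>semidirect_int B \<alpha>\<^esub> F = F"
    by (simp add: semidirect_int_def)
next
  fix g h F
  assume g: "g \<in> carrier (semidirect_int B \<alpha>)" and h: "h \<in> carrier (semidirect_int B \<alpha>)"
    and F: "F \<in> L2 \<mu>"
  obtain j b k c where eq: "g = (j, b)" "h = (k, c)"
    by (cases g, cases h)
  have b: "b \<in> carrier B" and c: "c \<in> carrier B"
    using g h by (simp_all add: eq semidirect_int_def)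
  have bc: "pow j c \<otimes> b \<in> carrier B"
    using b c pow_closed by simp
  have "rep_U B \<alpha> \<mu> (j, b) (rep_U B \<alpha> \<mu> (k, c) F) = rep_U B \<alpha> \<mu> (j + k, pow j c \<otimes> b) F"
    unfolding rep_U_eq
    by (rule weighted_composition_triangle[OF unimodular_U[OF b] unimodular_U[OF c] unimodular_U[OF bc] F])
       (simp_all add: space_haar b c dual_pow_apply dual_pow_dual_pow character_mult pow_closed add.commute)
  then show "rep_U B \<alpha> \<mu> (g \<otimes>\<^bsub>semidirect_int B \<alpha>\<^esub> h) F = rep_U B \<alpha> \<mu> g (rep_U B \<alpha> \<mu> h F)"
    by (simp add: eq semidirect_int_def)
qed

lemma u_t:
  assumes "h \<in> H" "F \<in> L2 \<mu>H"
  shows "op_u B H \<alpha> \<mu> (op_t B H \<mu> h F) = op_t B H \<mu> (\<alpha> h) (op_u B H \<alpha> \<mu> F)"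
proof -
  have "\<alpha> h \<in> H"
    using assms(1) H_invariant by blast
  then show ?thesis
    unfolding op_u_eq op_t_eq using assms
    by (intro weighted_composition_square unimodular_u unimodular_t)
       (simp_all add: space_muH endo_apply)
qed

lemma W_u:
  assumes "F \<in> L2 \<mu>H"
  shows "op_W B H \<mu> (op_u B H \<alpha> \<mu> F) = rep_U B \<alpha> \<mu> (1, \<one>) (op_W B H \<mu> F)"
  unfolding op_W_eq op_u_eq rep_U_eq using assms
  by (intro weighted_composition_square unimodular_u unimodular_W unimodular_U)
     (simp_all add: space_haar character_one theta_dual_aut auto_pow_one[OF \<alpha>])

lemma W_t:
  assumes "h \<in> H" "F \<in> L2 \<mu>H"
  shows "op_W B H \<mu> (op_t B H \<mu> h F) = rep_U B \<alpha> \<mu> (0, h) (op_W B H \<mu> F)"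
  unfolding op_W_eq op_t_eq rep_U_eq using assms
  by (intro weighted_composition_square unimodular_t unimodular_W unimodular_U)
     (simp_all only: space_haar theta_apply dual_pow_zero H_subset mult_1_left mult_1_right)

text \<open>\<open>proj j \<xi>\<close> is the character \<open>h \<mapsto> \<xi>(\<alpha>\<^sup>-\<^sup>j(h))\<close> of \<open>H\<close>, the restriction of \<open>\<xi>\<close> to \<open>\<alpha>\<^sup>-\<^sup>j(H)\<close> transported
  to \<open>H\<close>. Functions of it make up the subspace \<open>U(-j,0) W L\<^sup>2\<close>.\<close>

definition proj :: "nat \<Rightarrow> ('b \<Rightarrow> complex) \<Rightarrow> 'b \<Rightarrow> complex" where
  "proj j \<xi> = \<theta> (dual_aut B (pow (- int j)) \<xi>)"

lemma proj_closed: "\<xi> \<in> K \<Longrightarrow> proj j \<xi> \<in> KH"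
  by (simp add: proj_def theta_closed dual_pow_closed)

lemma proj_apply: "\<lbrakk>\<xi> \<in> K; h \<in> H\<rbrakk> \<Longrightarrow> proj j \<xi> h = \<xi> (pow (- int j) h)"
  by (simp add: proj_def theta_apply dual_pow_closed dual_pow_apply H_subset)

text \<open>Since \<open>\<alpha>\<^sup>-\<^sup>j(H) \<subseteq> \<alpha>\<^sup>-\<^sup>j\<^sup>-\<^sup>1(H)\<close>, each projection factors through the next, so the subspaces increase
  and their union is a subspace.\<close>

lemma endo_proj:
  assumes "\<xi> \<in> K"
  shows "\<alpha>H (proj (Suc j) \<xi>) = proj j \<xi>"
proof (rule character_eqI[of _ BH])
  fix h assume "h \<in> carrier BH"
  then have h: "h \<in> H" "\<alpha> h \<in> H"
    using H_invariant by auto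
  have "pow (- int (Suc j)) (\<alpha> h) = pow (- int j) h"
    using pow_pow[of h "- int (Suc j)" 1] h H_subset by (simp add: auto_pow_one[OF \<alpha>])
  then show "\<alpha>H (proj (Suc j) \<xi>) h = proj j \<xi> h"
    using assms h by (simp add: endo_apply proj_closed proj_apply)
qed (use assms in \<open>auto intro: proj_closed endo_closed\<close>)

text \<open>Equality is asked for on \<open>K\<close> only; elsewhere the dual maps return a fixed arbitrary value.\<close>

definition dilated :: "(('b \<Rightarrow> complex) \<Rightarrow> complex) set" where
  "dilated = {g \<in> square_integrable \<mu>.
     \<exists>j. \<exists>f\<in>square_integrable \<mu>H. \<forall>\<xi>\<in>K. g \<xi> = f (proj j \<xi>)}"

lemma factor_later:
  assumes "f \<in> square_integrable \<mu>H" "j \<le> k"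
  shows "\<exists>f'\<in>square_integrable \<mu>H. \<forall>\<xi>\<in>K. f (proj j \<xi>) = f' (proj k \<xi>)"
  using assms(2)
proof (induction k rule: dec_induct)
  case base
  then show ?case using assms(1) by blast
next
  case (step k)
  then obtain f' where f': "f' \<in> square_integrable \<mu>H" "\<forall>\<xi>\<in>K. f (proj j \<xi>) = f' (proj k \<xi>)"
    by blast
  have "weighted_composition (\<lambda>_. 1) \<alpha>H f' \<in> square_integrable \<mu>H"
    by (rule unimodular_composition.act_square_integrable[OF unimodular_u f'(1)])
  moreover have "\<forall>\<xi>\<in>K. f (proj j \<xi>) = weighted_composition (\<lambda>_. 1) \<alpha>H f' (proj (Suc k) \<xi>)"
    using f'(2) by (simp add: weighted_composition_def endo_proj)
  ultimately show ?case by blast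
qed

lemma dilated_add:
  assumes "g \<in> dilated" "g' \<in> dilated"
  shows "(\<lambda>\<xi>. g \<xi> + g' \<xi>) \<in> dilated"
proof -
  obtain j f where f: "f \<in> square_integrable \<mu>H" "\<forall>\<xi>\<in>K. g \<xi> = f (proj j \<xi>)"
    using assms(1) by (auto simp: dilated_def)
  obtain j' f' where f': "f' \<in> square_integrable \<mu>H" "\<forall>\<xi>\<in>K. g' \<xi> = f' (proj j' \<xi>)"
    using assms(2) by (auto simp: dilated_def)
  obtain h where h: "h \<in> square_integrable \<mu>H" "\<forall>\<xi>\<in>K. f (proj j \<xi>) = h (proj (max j j') \<xi>)"
    using factor_later[OF f(1), of j "max j j'"] by auto
  obtain h' where h': "h' \<in> square_integrable \<mu>H" "\<forall>\<xi>\<in>K. f' (proj j' \<xi>) = h' (proj (max j j') \<xi>)"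
    using factor_later[OF f'(1), of j' "max j j'"] by auto
  have "(\<lambda>z. h z + h' z) \<in> square_integrable \<mu>H"
    using h(1) h'(1) by (rule square_integrable_add)
  moreover have "\<forall>\<xi>\<in>K. g \<xi> + g' \<xi> = h (proj (max j j') \<xi>) + h' (proj (max j j') \<xi>)"
    using f(2) f'(2) h(2) h'(2) by simp
  moreover have "(\<lambda>\<xi>. g \<xi> + g' \<xi>) \<in> square_integrable \<mu>"
    using assms by (intro square_integrable_add) (auto simp: dilated_def)
  ultimately show ?thesis
    unfolding dilated_def
    by (intro CollectI conjI exI[of _ "max j j'"] bexI[of _ "\<lambda>z. h z + h' z"])
qed

lemma dilated_scale:
  assumes "g \<in> dilated"
  shows "(\<lambda>\<xi>. c * g \<xi>) \<in> dilated"
proof -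
  obtain j f where f: "f \<in> square_integrable \<mu>H" "\<forall>\<xi>\<in>K. g \<xi> = f (proj j \<xi>)"
    using assms by (auto simp: dilated_def)
  have "(\<lambda>z. c * f z) \<in> square_integrable \<mu>H" "(\<lambda>\<xi>. c * g \<xi>) \<in> square_integrable \<mu>"
    using f(1) assms by (auto simp: dilated_def intro: square_integrable_scale)
  then show ?thesis
    unfolding dilated_def using f(2)
    by (intro CollectI conjI exI[of _ j] bexI[of _ "\<lambda>z. c * f z"]) simp_all
qed

lemma zero_dilated: "(\<lambda>\<xi>. 0) \<in> dilated"
proof -
  have "(\<lambda>\<xi>. 0) \<in> square_integrable \<mu>" "(\<lambda>z. 0) \<in> square_integrable \<mu>H"
    by (simp_all add: square_integrable_def)
  then show ?thesis
    unfolding dilated_def by (intro CollectI conjI exI[of _ 0] bexI[of _ "\<lambda>z. 0"]) simp_all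
qed

text \<open>An element stays in \<open>H\<close> once a power of \<open>\<alpha>\<close> has brought it there, so the largest of finitely
  many exponents works for all.\<close>

lemma finite_subset_pulled_into_H:
  assumes "finite J" "J \<subseteq> carrier B"
  shows "\<exists>j. \<forall>b\<in>J. pow (int j) b \<in> H"
  using assms
proof (induction J rule: finite_induct)
  case empty
  then show ?case by simp
next
  case (insert b J)
  have later: "pow (int k) b \<in> H" if "pow (int j) b \<in> H" "j \<le> k" "b \<in> carrier B" for j k b
    using that(2)
  proof (induction k rule: dec_induct)
    case base
    show ?case by fact
  next
    case (step k)
    have "pow (int (Suc k)) b = \<alpha> (pow (int k) b)"
      using pow_pow[of b 1 "int k"] that(3) by (simp add: auto_pow_one[OF \<alpha>])
    then show ?case
      using step.IH H_invariant by auto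
  qed
  obtain j where j: "\<forall>b\<in>J. pow (int j) b \<in> H"
    using insert by auto
  have "b \<in> carrier B"
    using insert.prems by simp
  then obtain n h where "h \<in> H" "b = pow (- int n) h"
    using H_exhausts by blast
  then have "pow (int n) b = h"
    using pow_pow[of h "int n" "- int n"] by (simp add: H_subset one_AutoGroup)
  then have "pow (int n) b \<in> H"
    using \<open>h \<in> H\<close> by simp
  then have "pow (int (max j n)) c \<in> H" if "c \<in> insert b J" for c
    using that j insert.prems by (auto intro: later[of j] later[of n])
  then show ?case by blast
qed

text \<open>A cylinder involves finitely many elements \<open>b\<close> of \<open>B\<close>, and some power of \<open>\<alpha>\<close> moves all of them into
  \<open>H\<close>. The value \<open>\<xi>(b)\<close> is then \<open>proj j \<xi>\<close> evaluated at \<open>\<alpha>\<^sup>j(b)\<close>.\<close>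

lemma indicator_cylinder_dilated:
  assumes J: "finite J" "J \<subseteq> carrier B" and A: "A \<in> sets (Pi\<^sub>M J (\<lambda>_. borel))"
  shows "indicator (cylinder B J A) \<in> dilated"
proof -
  obtain j where j: "\<And>b. b \<in> J \<Longrightarrow> pow (int j) b \<in> H"
    using finite_subset_pulled_into_H[OF J] by blast
  define r where "r = (\<lambda>z :: 'b \<Rightarrow> complex. \<lambda>b\<in>J. z (pow (int j) b))"
  define f :: "('b \<Rightarrow> complex) \<Rightarrow> complex" where "f = indicator (r -` A \<inter> space \<mu>H)"
  have r: "r \<in> measurable \<mu>H (Pi\<^sub>M J (\<lambda>_. borel))"
    unfolding r_def by (intro measurable_restrict evaluation_measurable_muH j)
  have "f \<in> borel_measurable \<mu>H"
    unfolding f_def by (intro borel_measurable_indicator measurable_sets[OF r A])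
  then have "f \<in> square_integrable \<mu>H"
    by (rule square_integrable_bounded[OF finite_measure_muH, where C = 1]) (simp add: f_def indicator_def)
  moreover have "indicator (cylinder B J A) \<in> borel_measurable \<mu>"
    by (intro borel_measurable_indicator cylinder_measurable J A)
  then have "indicator (cylinder B J A) \<in> square_integrable \<mu>"
    by (rule square_integrable_bounded[OF finite_measure_axioms, where C = 1]) (simp add: indicator_def)
  moreover have "indicator (cylinder B J A) \<xi> = f (proj j \<xi>)" if \<xi>: "\<xi> \<in> K" for \<xi>
  proof -
    have "proj j \<xi> (pow (int j) b) = \<xi> b" if "b \<in> J" for b
      using that J(2) j \<xi> by (simp add: proj_apply pow_pow subset_iff one_AutoGroup)
    then have "r (proj j \<xi>) = restrict \<xi> J"
      by (auto simp: r_def)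
    then show ?thesis
      using \<xi> proj_closed[OF \<xi>] by (simp add: f_def indicator_def cylinder_def space_muH)
  qed
  ultimately show ?thesis
    unfolding dilated_def by (intro CollectI conjI exI[of _ j] bexI[of _ f]) auto
qed

lemma integral_indicator_diff:
  assumes "S \<in> sets \<mu>" "T \<in> sets \<mu>" "S \<subseteq> T"
  shows "(LINT \<xi>|\<mu>. (cmod (indicator T \<xi> - indicator S \<xi>))\<^sup>2) = measure \<mu> T - measure \<mu> S"
proof -
  have "(\<lambda>\<xi>. (cmod (indicator T \<xi> - indicator S \<xi>))\<^sup>2) = indicator (T - S)"
    using assms(3) by (auto simp: indicator_def fun_eq_iff)
  then have "(LINT \<xi>|\<mu>. (cmod (indicator T \<xi> - indicator S \<xi>))\<^sup>2) = measure \<mu> (T - S)"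
    using assms(1,2) by (simp add: Int_absorb2 sets.sets_into_space)
  then show ?thesis
    using assms by (simp add: finite_measure_Diff)
qed

text \<open>Outer regularity replaces a Borel set by an open one, inner regularity that by a cylinder.\<close>

lemma indicator_approximable:
  assumes A: "A \<in> sets \<mu>"
  shows "l2_approximable \<mu> dilated (indicator A)"
proof -
  have dilated: "dilated \<subseteq> square_integrable \<mu>"
    by (auto simp: dilated_def)
  have ind: "indicator S \<in> square_integrable \<mu>" if "S \<in> sets \<mu>" for S
    by (rule square_integrable_bounded[OF finite_measure_axioms, where C = 1])
       (use that in \<open>auto simp: indicator_def\<close>)
  have openU: "l2_approximable \<mu> dilated (indicator U)" if U: "openin (dual_topology B) U" for U
    unfolding l2_approximable_def
  proof (intro allI impI)
    fix e :: real assume "e > 0"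
    obtain J A where J: "finite J" "J \<subseteq> carrier B" "A \<in> sets (Pi\<^sub>M J (\<lambda>_. borel))"
      and V: "cylinder B J A \<subseteq> U" "measure \<mu> U < measure \<mu> (cylinder B J A) + e"
      by (rule open_inner_cylinder[OF U \<open>e > 0\<close>])
    have "(LINT \<xi>|\<mu>. (cmod (indicator U \<xi> - indicator (cylinder B J A) \<xi>))\<^sup>2) < e"
      using integral_indicator_diff[OF cylinder_measurable[OF J(2,3)] open_measurable[OF U] V(1)] V(2)
      by simp
    then show "\<exists>g\<in>dilated. (LINT \<xi>|\<mu>. (cmod (indicator U \<xi> - g \<xi>))\<^sup>2) < e"
      using indicator_cylinder_dilated[OF J] by (rule bexI)
  qed
  show ?thesis
  proof (rule l2_approximable_trans[OF dilated ind[OF A]])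
    fix e :: real assume "e > 0"
    obtain U where U: "openin (dual_topology B) U" "A \<subseteq> U" "measure \<mu> U < measure \<mu> A + e"
      by (rule Borel_outer_open[OF A \<open>e > 0\<close>])
    have "(LINT \<xi>|\<mu>. (cmod (indicator A \<xi> - indicator U \<xi>))\<^sup>2) < e"
      using integral_indicator_diff[OF A open_measurable[OF U(1)] U(2)] U(3)
      by (simp add: norm_minus_commute)
    then show "\<exists>g\<in>square_integrable \<mu>. l2_approximable \<mu> dilated g \<and>
        (LINT \<xi>|\<mu>. (cmod (indicator A \<xi> - g \<xi>))\<^sup>2) < e"
      using openU[OF U(1)] ind[OF open_measurable[OF U(1)]] by (intro bexI[of _ "indicator U"] conjI)
  qed
qed

lemma dilated_subspaces_dense:
  "l2_dense \<mu> (\<Union>j::nat. rep_U B \<alpha> \<mu> (- int j, \<one>) ` op_W B H \<mu> ` L2 \<mu>H)"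
proof (rule l2_dense_mono)
  show "l2_dense \<mu> (l2_class \<mu> ` dilated)"
  proof (rule l2_dense_if_indicators_approximable)
    show "finite_measure \<mu>" by unfold_locales
    show "dilated \<subseteq> square_integrable \<mu>" by (auto simp: dilated_def)
  qed (fact zero_dilated dilated_add dilated_scale indicator_approximable)+
  show "l2_class \<mu> ` dilated \<subseteq> (\<Union>j::nat. rep_U B \<alpha> \<mu> (- int j, \<one>) ` op_W B H \<mu> ` L2 \<mu>H)"
  proof (rule image_subsetI)
    fix g assume "g \<in> dilated"
    then obtain j f where g: "g \<in> square_integrable \<mu>" and f: "f \<in> square_integrable \<mu>H"
      and gf: "\<forall>\<xi>\<in>K. g \<xi> = f (proj j \<xi>)"
      by (auto simp: dilated_def)
    interpret W: unimodular_composition \<mu>H \<mu> "\<lambda>_. 1" \<theta> by (rule unimodular_W)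
    interpret U: unimodular_composition \<mu> \<mu> "\<lambda>\<xi>. \<xi> \<one>" "dual_aut B (pow (- int j))"
      by (rule unimodular_U) simp
    have "l2_class \<mu> g = l2_class \<mu> (U.act (W.act f))"
      using gf by (intro l2_class_cong g)
        (simp add: space_haar weighted_composition_def character_one proj_def)
    also have "\<dots> = rep_U B \<alpha> \<mu> (- int j, \<one>) (op_W B H \<mu> (l2_class \<mu>H f))"
      using f by (simp only: rep_U_eq op_W_eq U.lift_class W.lift_class W.act_square_integrable)
    finally show "l2_class \<mu> g \<in> (\<Union>j::nat. rep_U B \<alpha> \<mu> (- int j, \<one>) ` op_W B H \<mu> ` L2 \<mu>H)"
      using l2_class_in_L2[OF f] by blast
  qed
  show "(\<Union>j::nat. rep_U B \<alpha> \<mu> (- int j, \<one>) ` op_W B H \<mu> ` L2 \<mu>H) \<subseteq> L2 \<mu>"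
  proof (clarify)
    fix j :: nat and F assume "F \<in> L2 \<mu>H"
    then have "op_W B H \<mu> F \<in> L2 \<mu>"
      unfolding op_W_eq by (rule unimodular_composition.lift_in_L2[OF unimodular_W])
    then show "rep_U B \<alpha> \<mu> (- int j, \<one>) (op_W B H \<mu> F) \<in> L2 \<mu>"
      unfolding rep_U_eq by (rule unimodular_composition.lift_in_L2[OF unimodular_U[OF one_closed]])
  qed
qed

end

theorem proposition8p2:
  fixes B :: "('b, 'm) monoid_scheme" and \<alpha> :: "'b \<Rightarrow> 'b" and H :: "'b set"
    and \<mu> :: "('b \<Rightarrow> complex) measure"
  assumes "comm_group B"
    and "\<alpha> \<in> auto B"
    and "normalized_haar_measure (dual_group B) (dual_topology B) \<mu>"
    and "subgroup H B"
    and "\<alpha> ` H \<subseteq> H"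
    and "(\<Union>n::nat. (\<alpha> [^]\<^bsub>AutoGroup B\<^esub> (- int n)) ` H) = carrier B"
  shows
    "((\<forall>h\<in>H. \<forall>F\<in>L2 (mu_sub B H \<mu>).
        op_u B H \<alpha> \<mu> (op_t B H \<mu> h F) = op_t B H \<mu> (\<alpha> h) (op_u B H \<alpha> \<mu> F)) \<and>
     (\<forall>h\<in>H. l2_unitary (mu_sub B H \<mu>) (op_t B H \<mu> h)) \<and>
     l2_isometry (mu_sub B H \<mu>) (mu_sub B H \<mu>) (op_u B H \<alpha> \<mu>)) \<and>
     (unitary_representation (semidirect_int B \<alpha>) \<mu> (rep_U B \<alpha> \<mu>) \<and>
     l2_isometry (mu_sub B H \<mu>) \<mu> (op_W B H \<mu>) \<and>
     (\<forall>F\<in>L2 (mu_sub B H \<mu>).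
        op_W B H \<mu> (op_u B H \<alpha> \<mu> F) = rep_U B \<alpha> \<mu> (1, \<one>\<^bsub>B\<^esub>) (op_W B H \<mu> F)) \<and>
     (\<forall>h\<in>H. \<forall>F\<in>L2 (mu_sub B H \<mu>).
        op_W B H \<mu> (op_t B H \<mu> h F) = rep_U B \<alpha> \<mu> (0, h) (op_W B H \<mu> F)) \<and>
     l2_dense \<mu> (\<Union>j::nat. rep_U B \<alpha> \<mu> (- int j, \<one>\<^bsub>B\<^esub>) ` op_W B H \<mu> ` L2 (mu_sub B H \<mu>)))"
proof -
  interpret dilation B \<mu> \<alpha> H
    using assms by (intro dilation.intro dual_haar.intro dual_haar_axioms.intro dilation_axioms.intro)
  have "l2_isometry (mu_sub B H \<mu>) (mu_sub B H \<mu>) (op_u B H \<alpha> \<mu>)"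
    unfolding op_u_eq by (rule unimodular_composition.isometry_lift[OF unimodular_u])
  moreover have "l2_isometry (mu_sub B H \<mu>) \<mu> (op_W B H \<mu>)"
    unfolding op_W_eq by (rule unimodular_composition.isometry_lift[OF unimodular_W])
  ultimately show ?thesis
    by (intro conjI ballI u_t unitary_t representation_U W_u W_t dilated_subspaces_dense)
qed

end
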